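(* Let $p$ be a prime, $x\in\mathbb{Z}_p$, and let $r\ge 0$ be an integer. Let $m:=\langle -x\rangle_p$ and $s:=(x+\langle -x\rangle_p)/p\in\mathbb{Z}_p$. (i) If $p>r+3$ then $$\sum_{k=1}^{p-1}\frac{(x)_k}{(1)_k}\cdot\frac{S_k(\{1\}^r)}{k}\equiv -H^{(r+1)}_{m}-(-1)^r\,s\,p\,B_{p-r-2}(x)\pmod{p^2}.$$ (ii) If $p>2r+3$ then $$\sum_{k=1}^{p-1}\frac{(x)_k(1-x)_k}{(1)_k^2}\cdot\frac{S_k(\{2\}^r)}{k}\equiv -2H^{(2r+1)}_{m}-2(2r+1)\,s\,p\,H^{(2r+2)}_{m}+\frac{2s(1+3sr+2sr^2)}{2r+3}\,p^2B_{p-2r-3}(x)\pmod{p^3}.$$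
   Context: $\mathbb{Z}_p$ is the ring of $p$-adic integers; congruences modulo $p^a$ are congruences in $\mathbb{Z}_p$. For $y\in\mathbb{Z}_p$, $\langle y\rangle_p\in\{0,1,\dots,p-1\}$ is the least non-negative residue of $y$ modulo $p$. $(x)_n:=x(x+1)\cdots(x+n-1)$ is the Pochhammer symbol, with $(x)_0=1$, so $(1)_n=n!$. $B_n(x)$ is the $n$-th Bernoulli polynomial. For $t\ge1$, $H_n^{(t)}:=\sum_{j=1}^n \frac1{j^t}$ (so $H_0^{(t)}=0$). For positive integers $t_1,\dots,t_r$, the non-strict multiple harmonic sum is $$S_n(t_1,\dots,t_r):=\sum_{1\le j_1\le\cdots\le j_r\le n}\frac{1}{j_1^{t_1}\cdots j_r^{t_r}},$$ and $S_n(\{t\}^r)$ denotes $S_n(t,\dots,t)$ with $t$ repeated $r$ times; for $r=0$, $S_n(\{t\}^0)=1$. *)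

theory Defs
  imports
    "Berlekamp_Zassenhaus.Finite_Field"
    "HOL-Computational_Algebra.Fraction_Field"
    "HOL-Computational_Algebra.Formal_Power_Series"
begin

section \<open>The ring of p-adic integers and its field of fractions\<close>

text \<open>
  The prime is a type parameter \<open>'p :: prime_card\<close> with \<open>p = CARD('p)\<close>. A p-adic integer is an
  element of the inverse limit of the rings Z / p^n, represented by its reduced residues: the
  compatibility condition also forces \<open>0 \<le> f n < p ^ n\<close>.
\<close>

typedef (overloaded) ('p :: prime_card) padic_int =
  "{f :: nat \<Rightarrow> int. \<forall>n. f (Suc n) mod int CARD('p) ^ n = f n}"
  morphisms padic_residue Abs_padic_int
  by (rule exI[of _ "\<lambda>_. 0"]) simp

setup_lifting type_definition_padic_int

lemma mod_power_Suc_mod: "(a :: int) mod p ^ Suc n mod p ^ n = a mod p ^ n"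
  by (simp add: mod_mod_cancel)

instantiation padic_int :: (prime_card) comm_ring_1
begin

lift_definition zero_padic_int :: "'a padic_int" is "\<lambda>_. 0" by simp

lift_definition one_padic_int :: "'a padic_int" is "\<lambda>n. 1 mod int CARD('a) ^ n"
  by (simp only: mod_power_Suc_mod simp_thms)

lift_definition plus_padic_int :: "'a padic_int \<Rightarrow> 'a padic_int \<Rightarrow> 'a padic_int"
  is "\<lambda>f g n. (f n + g n) mod int CARD('a) ^ n"
  by (simp only: mod_power_Suc_mod) (metis mod_add_eq)

lift_definition minus_padic_int :: "'a padic_int \<Rightarrow> 'a padic_int \<Rightarrow> 'a padic_int"
  is "\<lambda>f g n. (f n - g n) mod int CARD('a) ^ n"
  by (simp only: mod_power_Suc_mod) (metis mod_diff_eq)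

lift_definition uminus_padic_int :: "'a padic_int \<Rightarrow> 'a padic_int"
  is "\<lambda>f n. (- f n) mod int CARD('a) ^ n"
  by (simp only: mod_power_Suc_mod) (metis mod_minus_eq)

lift_definition times_padic_int :: "'a padic_int \<Rightarrow> 'a padic_int \<Rightarrow> 'a padic_int"
  is "\<lambda>f g n. (f n * g n) mod int CARD('a) ^ n"
  by (simp only: mod_power_Suc_mod) (metis mod_mult_eq)

lemma padic_residue_mod [simp]: "padic_residue (x :: 'a padic_int) n mod int CARD('a) ^ n = padic_residue x n"
  by transfer (metis mod_mod_trivial)

instance
proof
  fix a b c :: "'a padic_int"
  show "a * b * c = a * (b * c)"
    by transfer (simp add: mod_simps mult.assoc)
  show "a * b = b * a"
    by transfer (simp add: mult.commute)
  show "1 * a = a"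
    by transfer (auto simp: mod_simps fun_eq_iff, metis mod_mod_trivial)
  show "a + b + c = a + (b + c)"
    by transfer (simp add: mod_simps add.assoc)
  show "a + b = b + a"
    by transfer (simp add: add.commute)
  show "0 + a = a"
    by transfer (auto simp: fun_eq_iff, metis mod_mod_trivial)
  show "- a + a = 0"
    by transfer (simp add: mod_simps)
  show "a - b = a + - b"
    by transfer (simp add: mod_simps)
  show "(a + b) * c = a * c + b * c"
    by transfer (simp add: mod_simps distrib_right)
  have "padic_residue (0 :: 'a padic_int) 1 \<noteq> padic_residue 1 1"
    using prime_card[where 'a = 'a] prime_gt_1_nat by (simp add: zero_padic_int.rep_eq one_padic_int.rep_eq)
  then show "(0 :: 'a padic_int) \<noteq> 1"
    by metis
qed

end

lemma padic_residue_of_nat: "padic_residue (of_nat k :: 'p :: prime_card padic_int) n = int k mod int CARD('p) ^ n"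
proof (induction k)
  case (Suc k)
  then show ?case
    by (simp add: plus_padic_int.rep_eq one_padic_int.rep_eq mod_simps)
qed (simp add: zero_padic_int.rep_eq)

lemma padic_residue_mod_le:
  fixes x :: "'p :: prime_card padic_int"
  assumes "m \<le> n"
  shows "padic_residue x n mod int CARD('p) ^ m = padic_residue x m"
  using assms
proof (induction n rule: dec_induct)
  case (step n)
  have "padic_residue x (Suc n) mod int CARD('p) ^ m
      = padic_residue x (Suc n) mod int CARD('p) ^ n mod int CARD('p) ^ m"
    using step.hyps by (simp add: mod_mod_cancel le_imp_power_dvd)
  also have "padic_residue x (Suc n) mod int CARD('p) ^ n = padic_residue x n"
    using padic_residue[of x] by simp
  finally show ?case
    using step.IH by simp
qed simp

instance padic_int :: (prime_card) idom
proof
  fix x y :: "'a padic_int"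
  let ?p = "int CARD('a)"
  assume "x \<noteq> 0" "y \<noteq> 0"
  then obtain a b where ab: "padic_residue x a \<noteq> 0" "padic_residue y b \<noteq> 0"
    by (metis (no_types, lifting) ext padic_residue_inject zero_padic_int.rep_eq)
  have "\<not> ?p ^ a dvd padic_residue x (a + b)" "\<not> ?p ^ b dvd padic_residue y (a + b)"
    using ab padic_residue_mod_le[of a "a + b" x] padic_residue_mod_le[of b "a + b" y]
    by (auto simp: dvd_eq_mod_eq_0)
  moreover have "prime_elem ?p"
    using prime_card[where 'a = 'a] by simp
  moreover have "a > 0"
    using ab padic_residue_mod[of x a] by (cases a) auto
  ultimately have "\<not> ?p ^ (a + b - 1) dvd padic_residue x (a + b) * padic_residue y (a + b)"
    using prime_elem_power_dvd_cases[of ?p "a + b - 1" "padic_residue x (a + b)" "padic_residue y (a + b)" a b]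
    by auto
  then have "\<not> ?p ^ (a + b) dvd padic_residue x (a + b) * padic_residue y (a + b)"
    by (meson diff_le_self dvd_trans le_imp_power_dvd)
  then have "padic_residue (x * y) (a + b) \<noteq> padic_residue 0 (a + b)"
    by (simp add: times_padic_int.rep_eq zero_padic_int.rep_eq dvd_eq_mod_eq_0)
  then show "x * y \<noteq> 0"
    by metis
qed

instance padic_int :: (prime_card) ring_char_0
proof
  show "inj (of_nat :: nat \<Rightarrow> 'a padic_int)"
  proof (rule injI)
    fix k l :: nat
    assume eq: "(of_nat k :: 'a padic_int) = of_nat l"
    have *: "i < CARD('a) ^ (k + l)" if "i \<le> k + l" for i
    proof -
      have "i < 2 ^ (k + l)"
        using that less_exp[of "k + l"] by linarith
      also have "\<dots> \<le> CARD('a) ^ (k + l)"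
        using prime_card[where 'a = 'a] prime_ge_2_nat by (intro power_mono) auto
      finally show ?thesis .
    qed
    have "int k mod int CARD('a) ^ (k + l) = int l mod int CARD('a) ^ (k + l)"
      using eq by (metis padic_residue_of_nat)
    then show "k = l"
      using *[of k] *[of l] by (simp flip: of_nat_power zmod_int)
  qed
qed

text \<open>The characterisation of divisibility by powers of p shows that the kernel of the n-th
  projection is the ideal generated by \<open>p ^ n\<close>.\<close>

lemma p_power_dvd_iff:
  fixes x :: "'p :: prime_card padic_int"
  shows "of_nat CARD('p) ^ n dvd x \<longleftrightarrow> padic_residue x n = 0"
proof
  assume "of_nat CARD('p) ^ n dvd x"
  then obtain y where "x = of_nat (CARD('p) ^ n) * y"
    by auto
  then show "padic_residue x n = 0"
    by (simp only: times_padic_int.rep_eq padic_residue_of_nat) simp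
next
  let ?p = "int CARD('p)"
  assume 0: "padic_residue x n = 0"
  have p: "?p \<noteq> 0"
    by simp
  define g where "g k = padic_residue x (k + n) div ?p ^ n" for k
  have dvd: "?p ^ n dvd padic_residue x (k + n)" for k
    using padic_residue_mod_le[of n "k + n" x] 0 by (simp add: dvd_eq_mod_eq_0)
  then have g: "padic_residue x (k + n) = ?p ^ n * g k" for k
    by (simp add: g_def)
  have "g (Suc k) mod ?p ^ k = g k" for k
  proof -
    have "?p ^ n * (g (Suc k) mod ?p ^ k) = padic_residue x (Suc k + n) mod ?p ^ (k + n)"
      by (simp only: g mult_mod_right) (simp add: power_add mult.commute)
    also have "\<dots> = ?p ^ n * g k"
      by (subst padic_residue_mod_le) (simp_all flip: g)
    finally show ?thesis
      using p by simp
  qed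
  then have res: "padic_residue (Abs_padic_int g :: 'p padic_int) = g"
    by (intro Abs_padic_int_inverse) simp
  have "padic_residue x k = padic_residue (of_nat (CARD('p) ^ n) * Abs_padic_int g :: 'p padic_int) k" for k
    using padic_residue_mod_le[of k "k + n" x]
    by (simp only: times_padic_int.rep_eq padic_residue_of_nat res g) (simp add: mod_simps)
  then have "x = of_nat (CARD('p) ^ n) * Abs_padic_int g"
    by (simp add: padic_residue_inject[symmetric] fun_eq_iff)
  then show "of_nat CARD('p) ^ n dvd x"
    by simp
qed

instance fract :: ("{idom, ring_char_0}") field_char_0
proof
  show "inj (of_nat :: nat \<Rightarrow> 'a fract)"
  proof (rule injI)
    fix k l :: nat
    assume "(of_nat k :: 'a fract) = of_nat l"
    then show "k = l"
      by (simp add: Fract_of_nat_eq[symmetric] eq_fract)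
  qed
qed

type_synonym 'p padic = "'p padic_int fract"

definition of_padic_int :: "'p :: prime_card padic_int \<Rightarrow> 'p padic" where
  "of_padic_int x = Fract x 1"

text \<open>Congruence in the ring of p-adic integers of two elements of the p-adic field; in
  particular both sides are required to be p-adic integers.\<close>

definition padic_cong :: "'p :: prime_card padic \<Rightarrow> 'p padic \<Rightarrow> 'p padic_int \<Rightarrow> bool" where
  "padic_cong a b c \<longleftrightarrow> (\<exists>u v. a = of_padic_int u \<and> b = of_padic_int v \<and> c dvd u - v)"

definition least_residue :: "'p :: prime_card padic_int \<Rightarrow> nat" where
  "least_residue y = (LEAST m. of_nat CARD('p) dvd y - of_nat m)"

lemma least_residue:
  fixes y :: "'p :: prime_card padic_int"
  shows "least_residue y < CARD('p)" and "of_nat CARD('p) dvd y - of_nat (least_residue y)"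
proof -
  let ?k = "nat (padic_residue y 1)"
  have r: "padic_residue y 1 mod int CARD('p) = padic_residue y 1"
    using padic_residue_mod[of y 1] by simp
  have "0 \<le> padic_residue y 1 mod int CARD('p)" "padic_residue y 1 mod int CARD('p) < int CARD('p)"
    by simp_all
  then have bounds: "0 \<le> padic_residue y 1" "padic_residue y 1 < int CARD('p)"
    unfolding r by simp_all
  then have "padic_residue (y - of_nat ?k) 1 = 0"
    by (simp only: minus_padic_int.rep_eq padic_residue_of_nat) (simp add: mod_simps)
  then have k: "of_nat CARD('p) dvd y - of_nat ?k"
    using p_power_dvd_iff[of 1 "y - of_nat ?k"] by simp
  show "of_nat CARD('p) dvd y - of_nat (least_residue y)"
    unfolding least_residue_def using k by (rule LeastI)
  have "least_residue y \<le> ?k"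
    unfolding least_residue_def using k by (rule Least_le)
  then show "least_residue y < CARD('p)"
    using bounds by linarith
qed

section \<open>Harmonic sums and Bernoulli polynomials\<close>

definition gharm :: "nat \<Rightarrow> nat \<Rightarrow> 'a :: field_char_0" where
  "gharm t n = (\<Sum>j=1..n. 1 / of_nat j ^ t)"

text \<open>The index tuples \<open>1 \<le> j\<^sub>1 \<le> \<dots> \<le> j\<^sub>r \<le> n\<close> are sorted lists as long as \<open>ts\<close>.\<close>

definition mhsum :: "nat \<Rightarrow> nat list \<Rightarrow> 'a :: field_char_0" where
  "mhsum n ts =
     (\<Sum>js | length js = length ts \<and> sorted js \<and> set js \<subseteq> {1..n}.
        \<Prod>i<length ts. 1 / of_nat (js ! i) ^ (ts ! i))"

text \<open>\<open>B\<^sub>n(x)\<close>, defined by the generating function \<open>t e\<^sup>x\<^sup>t / (e\<^sup>t - 1) = \<Sum> B\<^sub>n(x) t\<^sup>n / n!\<close>.\<close>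

definition bernpoly :: "nat \<Rightarrow> 'a :: field_char_0 \<Rightarrow> 'a" where
  "bernpoly n x = fact n * fps_nth (fps_X * fps_exp x / (fps_exp 1 - 1)) n"

end

theory Submission
  imports Defs
begin

text \<open>
  The left-hand sides are values of polynomials with p-integral coefficients, which summation by
  parts evaluates exactly at the integers \<open>- m\<close>, \<open>0 \<le> m < p\<close>. Since \<open>x = - m + p s\<close>, Taylor's formula
  reduces both congruences to the derivatives of these polynomials. In (i) the degree is below p, so
  the values determine the polynomial modulo p; it is a difference of Bernoulli polynomials. In (ii)
  the polynomial F has degree at most \<open>2 p - 2\<close> and satisfies \<open>F(1 - x) = F(x)\<close>, so it is also known
  exactly at \<open>p - m\<close>. This gives \<open>p F' + p\<^sup>2 F'' / 2\<close> modulo \<open>p\<^sup>3\<close> at \<open>- m\<close>, and the values of F and \<open>F'\<close>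
  determine F modulo p, hence \<open>F''\<close>. The harmonic numbers of index \<open>p - 1\<close> that occur are obtained from
  (i) at \<open>x = 1\<close> and Newton's identities.
\<close>

section \<open>Bernoulli polynomials\<close>

text \<open>Bernoulli polynomials enter through Fermat: modulo \<open>p\<close>,
  \<open>1 / j ^ e\<close> is \<open>j ^ (p - 1 - e)\<close>, so a harmonic number of index
  \<open>m\<close> is a power sum and, up to sign, the value at \<open>- m\<close> of an
  antiderivative of \<open>B_n(1 - X)\<close>. The obstacle in (ii) is that Taylor's formula at
  \<open>- m\<close> asks for \<open>F'\<close> modulo \<open>p ^ 2\<close>, whereas comparing the
  two exact values at distance \<open>p\<close> yields only the combination
  \<open>p F' + p ^ 2 F'' / 2\<close>. The way round is to write
  \<open>p s F' + p ^ 2 s ^ 2 F'' / 2\<close> as \<open>s\<close> times that combination plus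
  \<open>(s ^ 2 - s) / 2 * p ^ 2 F''\<close>, where \<open>F''\<close> matters only modulo
  \<open>p\<close>. Since \<open>F\<close> has degree below \<open>2 p\<close>, finding it modulo
  \<open>p\<close> is Hermite interpolation at the \<open>p\<close> residues, solved with
  \<open>X ^ p - X\<close>, which vanishes modulo \<open>p\<close> at each of them with derivative
  \<open>- 1\<close>. With \<open>t = 2 r + 1\<close> the two parts contribute
  \<open>s t (t + 1) / (t + 2)\<close> and \<open>(s ^ 2 - s) (t - 1)\<close>, whose sum is the
  coefficient of the Bernoulli term in (ii).\<close>

lemma bernpoly_gf:
  fixes x :: "'a::field_char_0"
  shows "Abs_fps (\<lambda>n. bernpoly n x / fact n) * (fps_exp 1 - 1) = fps_X * fps_exp x"
proof -
  \<comment> \<open>The divisor has constant term 0, so it is not a unit. The quotient defining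
    \<open>bernpoly\<close> is exact because the numerator also has order 1.\<close>
  have "subdegree (fps_exp 1 - 1 :: 'a fps) = 1"
    by (rule subdegreeI) auto
  then have "(fps_exp 1 - 1 :: 'a fps) \<noteq> 0" "subdegree (fps_exp 1 - 1 :: 'a fps) \<le> subdegree (fps_X * fps_exp x)"
    by (auto simp: subdegree_eq_0)
  moreover have "fps_X * fps_exp x \<noteq> 0"
    by simp
  ultimately have "(fps_exp 1 - 1 :: 'a fps) dvd fps_X * fps_exp x"
    by (simp add: fps_dvd_iff)
  moreover have "Abs_fps (\<lambda>n. bernpoly n x / fact n) = fps_X * fps_exp x / (fps_exp 1 - 1)"
    by (simp add: fps_eq_iff bernpoly_def)
  ultimately show ?thesis
    by simp
qed

lemma fps_exp_1_minus_1_cancel: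
  fixes f g :: "'a::field_char_0 fps"
  assumes "f * (fps_exp 1 - 1) = g * (fps_exp 1 - 1)"
  shows "f = g"
proof -
  have "fps_nth (fps_exp 1 - 1 :: 'a fps) 1 \<noteq> 0"
    by simp
  then have "(fps_exp 1 - 1 :: 'a fps) \<noteq> 0"
    by (metis fps_zero_nth)
  then show ?thesis
    using assms by simp
qed

lemma bernpoly_add_1:
  fixes x :: "'a::field_char_0"
  shows "bernpoly (Suc n) (x + 1) - bernpoly (Suc n) x = of_nat (Suc n) * x ^ n"
proof -
  define G where "G y = Abs_fps (\<lambda>n. bernpoly n (y::'a) / fact n)" for y
  have "(G (x + 1) - G x) * (fps_exp 1 - 1) = fps_X * fps_exp x * (fps_exp 1 - 1)"
    using bernpoly_gf[of x] bernpoly_gf[of "x + 1"]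
    by (simp add: G_def left_diff_distrib fps_exp_add_mult algebra_simps)
  then have "G (x + 1) - G x = fps_X * fps_exp x"
    by (rule fps_exp_1_minus_1_cancel)
  then have "fps_nth (G (x + 1) - G x) (Suc n) = fps_nth (fps_X * fps_exp x) (Suc n)"
    by simp
  then have "(bernpoly (Suc n) (x + 1) - bernpoly (Suc n) x) / fact (Suc n) = x ^ n / fact n"
    by (simp add: G_def diff_divide_distrib del: fact_Suc)
  then have "bernpoly (Suc n) (x + 1) - bernpoly (Suc n) x = fact (Suc n) / fact n * x ^ n"
    by (simp add: divide_eq_eq ac_simps del: fact_Suc)
  also have "fact (Suc n) / fact n = (of_nat (Suc n) :: 'a)"
    by (simp add: fact_Suc del: of_nat_Suc)
  finally show ?thesis .
qed

lemma bernpoly_1: "n > 0 \<Longrightarrow> bernpoly (Suc n) (1::'a::field_char_0) = bernpoly (Suc n) 0"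
  using bernpoly_add_1[of n "0::'a"] by (simp add: power_0_left)

lemma bernpoly_0_sum:
  fixes x :: "'a::field_char_0"
  shows "bernpoly n x = (\<Sum>i\<le>n. of_nat (n choose i) * bernpoly (n - i) 0 * x ^ i)"
proof -
  define G where "G y = Abs_fps (\<lambda>n. bernpoly n (y::'a) / fact n)" for y
  have "G x * (fps_exp 1 - 1) = (fps_exp x * G 0) * (fps_exp 1 - 1)"
    using bernpoly_gf[of x] bernpoly_gf[of "0::'a"] unfolding G_def mult.assoc by (simp add: mult.commute)
  then have "fps_nth (G x) n = fps_nth (fps_exp x * G 0) n"
    using fps_exp_1_minus_1_cancel by metis
  then have "bernpoly n x = fact n * (\<Sum>i=0..n. x ^ i / fact i * (bernpoly (n - i) 0 / fact (n - i)))"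
    by (simp add: G_def fps_mult_nth field_simps)
  also have "\<dots> = (\<Sum>i\<le>n. of_nat (n choose i) * bernpoly (n - i) 0 * x ^ i)"
    unfolding sum_distrib_left atLeast0AtMost
    by (intro sum.cong) (auto simp: binomial_fact field_simps)
  finally show ?thesis .
qed

text \<open>Replacing the variable \<open>z\<close> by \<open>- z\<close> in
  \<open>z e^(x z) / (e^z - 1)\<close> and multiplying numerator and denominator by
  \<open>e^z\<close> gives \<open>z e^((1 - x) z) / (e^z - 1)\<close>.\<close>

lemma bernpoly_reflect:
  fixes x :: "'a::field_char_0"
  shows "bernpoly n (1 - x) = (- 1) ^ n * bernpoly n x"
proof -
  define G where "G y = Abs_fps (\<lambda>n. bernpoly n (y::'a) / fact n)" for y
  have X: "(- fps_X :: 'a fps) = fps_const (- 1) * fps_X"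
    by (simp flip: fps_const_neg)
  have exp: "fps_exp c oo - fps_X = fps_exp (- c)" for c :: 'a
    unfolding X fps_compose_linear by (simp add: fps_eq_iff power_minus[of c])
  have "(G x * (fps_exp 1 - 1)) oo - fps_X = (fps_X * fps_exp x) oo - fps_X"
    using bernpoly_gf[of x] by (simp add: G_def)
  then have "(G x oo - fps_X) * (fps_exp (- 1) - 1) = - fps_X * fps_exp (- x)"
    by (simp add: fps_compose_mult_distrib fps_compose_sub_distrib exp)
  then have "(G x oo - fps_X) * (fps_exp (- 1) - 1) * fps_exp 1 = - fps_X * fps_exp (- x) * fps_exp 1"
    by simp
  moreover have "fps_exp (- x) * fps_exp 1 = fps_exp (1 - x)" "fps_exp (- 1) * fps_exp 1 = (1 :: 'a fps)"
    by (simp_all flip: fps_exp_add_mult)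
  ultimately have "(G x oo - fps_X) * (1 - fps_exp 1) = - (fps_X * fps_exp (1 - x))"
    by (simp add: left_diff_distrib right_diff_distrib mult.assoc)
  then have "(G x oo - fps_X) * (fps_exp 1 - 1) = fps_X * fps_exp (1 - x)"
    by (simp add: algebra_simps)
  also have "\<dots> = G (1 - x) * (fps_exp 1 - 1)"
    using bernpoly_gf[of "1 - x"] by (simp add: G_def)
  finally have "fps_nth (G x oo - fps_X) n = fps_nth (G (1 - x)) n"
    using fps_exp_1_minus_1_cancel by metis
  then show ?thesis
    by (simp add: G_def fps_compose_uminus')
qed

lemma bernpoly_sum_powers:
  "bernpoly (Suc n) (1 + of_nat m) - bernpoly (Suc n) 1 = (of_nat (Suc n) * (\<Sum>j=1..m. of_nat j ^ n) :: 'a::field_char_0)"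
proof (induction m)
  case (Suc m)
  then show ?case
    using bernpoly_add_1[of n "1 + of_nat m :: 'a"] by (simp add: algebra_simps)
qed auto

text \<open>\<open>bernpoly n\<close> is only a function of its argument; derivatives, degrees and
  integrality of coefficients require a formal polynomial.\<close>

definition bern_poly :: "nat \<Rightarrow> 'a::field_char_0 poly" where
  "bern_poly n = (\<Sum>i\<le>n. monom (of_nat (n choose i) * bernpoly (n - i) 0) i)"

lemma poly_bern_poly [simp]: "poly (bern_poly n) x = bernpoly n x"
  by (simp add: bern_poly_def poly_sum poly_monom bernpoly_0_sum[of n x])

lemma coeff_bern_poly: "coeff (bern_poly n) i = of_nat (n choose i) * bernpoly (n - i) 0"
  by (simp add: bern_poly_def coeff_sum coeff_monom)

lemma pderiv_bern_poly: "pderiv (bern_poly (Suc n)) = smult (of_nat (Suc n)) (bern_poly n)"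
proof (rule poly_eqI)
  fix i
  have "of_nat (Suc i) * of_nat (Suc n choose Suc i) = (of_nat (Suc n) * of_nat (n choose i) :: 'a)"
    unfolding of_nat_mult[symmetric] Suc_times_binomial ..
  then show "coeff (pderiv (bern_poly (Suc n))) i = coeff (smult (of_nat (Suc n)) (bern_poly n) :: 'a poly) i"
    by (simp add: coeff_pderiv coeff_bern_poly flip: mult.assoc del: of_nat_Suc)
qed

lemma degree_bern_poly: "degree (bern_poly n) \<le> n"
  by (rule degree_le) (simp add: coeff_bern_poly)

text \<open>This is \<open>B_(n+2)(1) = B_(n+2)(0)\<close> with the left side expanded: the term
  \<open>i = 0\<close> cancels and the term \<open>i = 1\<close> is isolated. Solving for
  \<open>B_(n+1)\<close> divides by \<open>n + 2\<close> only, which gives integrality as long as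
  this is below \<open>p\<close>.\<close>

lemma bernpoly_0_recurrence:
  "of_nat (Suc (Suc n)) * bernpoly (Suc n) (0::'a::field_char_0) =
     - (\<Sum>i\<le>n. of_nat (Suc (Suc n) choose Suc (Suc i)) * bernpoly (n - i) 0)"
proof -
  have "bernpoly (Suc (Suc n)) (1::'a) = bernpoly (Suc (Suc n)) 0"
    by (simp add: bernpoly_1)
  moreover have "bernpoly (Suc (Suc n)) (1::'a) =
      (\<Sum>i\<le>Suc (Suc n). of_nat (Suc (Suc n) choose i) * bernpoly (Suc (Suc n) - i) 0)"
    by (simp add: bernpoly_0_sum[of _ 1])
  ultimately show ?thesis
    unfolding sum.atMost_Suc_shift
    by (simp add: eq_neg_iff_add_eq_0 of_nat_Suc[of 0] del: binomial_Suc_Suc of_nat_Suc)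
qed

lemma bernpoly_0_0: "bernpoly 0 (0::'a::field_char_0) = 1"
  using bernpoly_add_1[of 0 "0::'a"] bernpoly_0_sum[of "Suc 0" "1::'a"] by simp

section \<open>Multiple harmonic sums with equal exponents\<close>

lemma mhsum_replicate:
  "mhsum n (replicate r t) =
     (\<Sum>js | length js = r \<and> sorted js \<and> set js \<subseteq> {1..n}. \<Prod>j\<leftarrow>js. 1 / of_nat j ^ t)"
  unfolding mhsum_def
  by (auto intro!: sum.cong simp: prod.list_conv_set_nth atLeast0LessThan)

lemma mhsum_0 [simp]: "mhsum n (replicate 0 t) = 1"
proof -
  have "{js. length js = 0 \<and> sorted js \<and> set js \<subseteq> {1..n}} = {[]}"
    by auto
  then show ?thesis
    by (simp only: mhsum_replicate) simp
qed

lemma mhsum_upto_0 [simp]: "mhsum 0 (replicate (Suc r) t) = 0"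
proof -
  have "{js. length js = Suc r \<and> sorted js \<and> set js \<subseteq> {1..0::nat}} = {}"
    by auto
  then show ?thesis
    by (simp only: mhsum_replicate) simp
qed

text \<open>Tuples are split by whether their last, hence largest, entry is \<open>Suc n\<close>.
  Deleting that entry leaves a tuple that may contain \<open>Suc n\<close> again, since the
  inequalities are not strict; so the upper limit stays \<open>Suc n\<close> while the length
  drops.\<close>

lemma mhsum_Suc:
  "mhsum (Suc n) (replicate (Suc r) t) =
     mhsum n (replicate (Suc r) t) + mhsum (Suc n) (replicate r t) / (of_nat (Suc n) ^ t :: 'a::field_char_0)"
proof -
  define J where "J n r = {js. length js = r \<and> sorted js \<and> set js \<subseteq> {1..n}}" for n r :: nat
  have finite: "finite (J n r)" for n r
    by (rule finite_subset[OF _ finite_lists_length_eq[of "{1..n}" r]]) (auto simp: J_def)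
  have "J (Suc n) (Suc r) = J n (Suc r) \<union> (\<lambda>js. js @ [Suc n]) ` J (Suc n) r"
  proof (intro equalityI subsetI)
    fix js
    assume js: "js \<in> J (Suc n) (Suc r)"
    then obtain ks j where ks: "js = ks @ [j]"
      by (cases js rule: rev_cases) (auto simp: J_def)
    show "js \<in> J n (Suc r) \<union> (\<lambda>js. js @ [Suc n]) ` J (Suc n) r"
    proof (cases "j = Suc n")
      case True
      with js ks show ?thesis
        by (auto simp: J_def sorted_append)
    next
      case False
      with js ks have "j \<le> n"
        by (auto simp: J_def)
      with js ks show ?thesis
        by (fastforce simp: J_def sorted_append)
    qed
  next
    fix js
    assume "js \<in> J n (Suc r) \<union> (\<lambda>js. js @ [Suc n]) ` J (Suc n) r"
    then show "js \<in> J (Suc n) (Suc r)"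
      by (fastforce simp: J_def sorted_append)
  qed
  moreover have "J n (Suc r) \<inter> (\<lambda>js. js @ [Suc n]) ` J (Suc n) r = {}"
    by (auto simp: J_def)
  ultimately have "(\<Sum>js\<in>J (Suc n) (Suc r). \<Prod>j\<leftarrow>js. 1 / of_nat j ^ t) =
      (\<Sum>js\<in>J n (Suc r). \<Prod>j\<leftarrow>js. 1 / of_nat j ^ t :: 'a) +
      (\<Sum>js\<in>(\<lambda>js. js @ [Suc n]) ` J (Suc n) r. \<Prod>j\<leftarrow>js. 1 / of_nat j ^ t)"
    by (simp add: sum.union_disjoint finite)
  also have "(\<Sum>js\<in>(\<lambda>js. js @ [Suc n]) ` J (Suc n) r. \<Prod>j\<leftarrow>js. 1 / of_nat j ^ t :: 'a) =
      (\<Sum>js\<in>J (Suc n) r. \<Prod>j\<leftarrow>js. 1 / of_nat j ^ t) / of_nat (Suc n) ^ t"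
    by (subst sum.reindex) (auto simp: inj_on_def sum_divide_distrib)
  finally show ?thesis
    by (simp only: mhsum_replicate J_def)
qed

lemma gharm_0 [simp]: "gharm t 0 = 0"
  by (simp add: gharm_def)

lemma gharm_Suc: "gharm t (Suc n) = gharm t n + 1 / of_nat (Suc n) ^ t"
  by (simp add: gharm_def)

text \<open>\<open>h\<close> is the product of the series \<open>1 / (1 - X / j ^ t)\<close>, and
  the claim is its logarithmic derivative. In the induction, multiplying by the denominator
  \<open>d\<close> of the new factor turns the series for \<open>Suc n\<close> into those for
  \<open>n\<close>.\<close>

lemma mhsum_newton_fps:
  fixes t n :: nat
  defines "h \<equiv> Abs_fps (\<lambda>r. mhsum n (replicate r t) :: 'a::field_char_0)"
  shows "fps_deriv h = Abs_fps (\<lambda>i. gharm (t * Suc i) n) * h"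
  unfolding h_def
proof (induction n)
  case 0
  have "mhsum 0 (replicate r t) = (if r = 0 then 1 else 0 :: 'a)" for r
    by (cases r) (auto simp del: replicate.simps)
  then show ?case
    by (simp add: fps_eq_iff fps_mult_nth)
next
  case (Suc n)
  define c :: 'a where "c = 1 / of_nat (Suc n) ^ t"
  define H where "H n = Abs_fps (\<lambda>r. mhsum n (replicate r t) :: 'a)" for n
  define P where "P n = Abs_fps (\<lambda>i. gharm (t * Suc i) n :: 'a)" for n
  define d where "d = 1 - fps_const c * fps_X"
  have d: "f * d = f - fps_const c * (fps_X * f)" for f
    by (simp add: d_def algebra_simps)
  have H: "H (Suc n) * d = H n"
  proof (rule fps_ext)
    fix r
    show "fps_nth (H (Suc n) * d) r = fps_nth (H n) r"
      by (cases r) (simp_all add: H_def d c_def mhsum_Suc del: replicate.simps of_nat_Suc)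
  qed
  have P: "P (Suc n) * d = P n * d + fps_const c"
  proof -
    have "P (Suc n) = P n + fps_const c * Abs_fps (\<lambda>i. c ^ i)"
      by (rule fps_ext) (simp add: P_def c_def gharm_Suc power_divide power_mult power_add del: of_nat_Suc)
    moreover have "Abs_fps (\<lambda>i. c ^ i) * d = 1"
      unfolding d by (rule fps_ext) (auto simp: gr0_conv_Suc)
    ultimately show ?thesis
      by (simp add: distrib_right mult.assoc)
  qed
  have "fps_deriv (H (Suc n)) * d - H (Suc n) * fps_const c = fps_deriv (H (Suc n) * d)"
    by (simp add: d_def flip: fps_const_neg)
  also have "\<dots> = fps_deriv (H n)"
    by (simp only: H)
  also have "\<dots> = P n * H n"
    using Suc.IH by (simp only: H_def P_def)
  also have "\<dots> = P n * (H (Suc n) * d)"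
    by (simp only: H)
  finally have "fps_deriv (H (Suc n)) * d = (P n * d + fps_const c) * H (Suc n)"
    by (simp add: algebra_simps)
  then have "fps_deriv (H (Suc n)) * d = P (Suc n) * H (Suc n) * d"
    unfolding P[symmetric] by (simp add: ac_simps)
  moreover have "d \<noteq> 0"
  proof -
    have "fps_nth d 0 \<noteq> 0"
      by (simp add: d_def)
    then show ?thesis
      by auto
  qed
  ultimately show ?case
    by (simp add: H_def P_def)
qed

text \<open>\<open>mhsum n (replicate r t)\<close> is the complete homogeneous symmetric polynomial of degree r in the
  \<open>1 / j\<^sup>t\<close>, and \<open>gharm (t * i) n\<close> the i-th power sum.\<close>

lemma mhsum_newton:
  "of_nat (Suc r) * mhsum n (replicate (Suc r) t) =
     (\<Sum>i\<le>r. gharm (t * Suc i) n * mhsum n (replicate (r - i) t) :: 'a::field_char_0)"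
  using arg_cong[OF mhsum_newton_fps[of n t], of "\<lambda>f. fps_nth f r"]
  by (simp add: fps_mult_nth atLeast0AtMost del: replicate.simps)

section \<open>Exact evaluation at non-positive integers\<close>

lemma sum_by_parts_lessThan:
  fixes T S :: "nat \<Rightarrow> 'a::comm_ring_1"
  shows "(\<Sum>k<n. (T (Suc k) - T k) * S (Suc k)) = T n * S n - T 0 * S 0 - (\<Sum>k<n. T k * (S (Suc k) - S k))"
  by (induction n) (auto simp: algebra_simps)

lemma pochhammer_1_minus_of_nat_eq_0:
  assumes "m \<in> {1..n}"
  shows "pochhammer (1 - of_nat m :: 'a::field_char_0) n = 0"
  unfolding pochhammer_eq_0_iff using assms by (intro exI[of _ "m - 1"]) (auto simp: of_nat_diff)

lemma pochhammer_div_fact_diff: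
  fixes x :: "'a::field_char_0"
  shows "pochhammer (x + 1) (Suc k) / fact (Suc k) - pochhammer (x + 1) k / fact k =
           pochhammer x (Suc k) / fact (Suc k)"
proof -
  have "of_nat (Suc k) \<noteq> (0 :: 'a)"
    by (rule of_nat_neq_0)
  then have nz: "1 + of_nat k \<noteq> (0 :: 'a)"
    by simp
  show ?thesis
    unfolding pochhammer_rec[of x] pochhammer_Suc[of "x + 1"] using nz
    by (simp add: divide_simps) (simp add: algebra_simps)
qed

text \<open>For \<open>x = - m\<close> the weight \<open>(x)_k / k!\<close> is
  \<open>(-1) ^ k\<close> times \<open>m choose k\<close>, and it is a difference of consecutive
  \<open>T\<close>, where \<open>T n = 0\<close> since \<open>m \<le> n\<close>. Summation by parts
  lowers \<open>r\<close> and leaves \<open>T k / (k + 1)\<close>, which is the weight at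
  \<open>k + 1\<close> divided by \<open>x\<close>; hence one factor \<open>1 / m\<close> per
  step.\<close>

lemma sum_pochhammer_mhsum:
  fixes m n r :: nat
  assumes "m \<in> {1..n}"
  shows "(\<Sum>k<n. pochhammer (- of_nat m) (Suc k) / fact (Suc k) * mhsum (Suc k) (replicate r 1)) =
           (- 1 / of_nat m ^ r :: 'a::field_char_0)"
proof -
  define x :: 'a where "x = - of_nat m"
  define T where "T k = pochhammer (x + 1) k / fact k" for k
  have T: "pochhammer x (Suc k) / fact (Suc k) = T (Suc k) - T k" for k
    using pochhammer_div_fact_diff[of x k] by (simp add: T_def)
  have "T n = 0"
    using pochhammer_1_minus_of_nat_eq_0[OF assms, where 'a = 'a] by (simp add: T_def x_def)
  have "x \<noteq> 0"
    using assms by (simp add: x_def)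
  have "(\<Sum>k<n. pochhammer x (Suc k) / fact (Suc k) * mhsum (Suc k) (replicate r 1)) = - 1 / of_nat m ^ r"
  proof (induction r)
    case 0
    show ?case
      unfolding T mhsum_0 mult_1_right sum_lessThan_telescope \<open>T n = 0\<close> by (simp add: T_def)
  next
    case (Suc r)
    have "(\<Sum>k<n. pochhammer x (Suc k) / fact (Suc k) * mhsum (Suc k) (replicate (Suc r) 1)) =
        - (\<Sum>k<n. T k * (mhsum (Suc k) (replicate r 1) / of_nat (Suc k)))"
      unfolding T using sum_by_parts_lessThan[of T "\<lambda>k. mhsum k (replicate (Suc r) 1)" n] \<open>T n = 0\<close>
      by (simp add: mhsum_Suc del: replicate.simps of_nat_Suc)
    also have "\<dots> = (\<Sum>k<n. pochhammer x (Suc k) / fact (Suc k) * mhsum (Suc k) (replicate r 1)) / (- x)"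
      unfolding sum_divide_distrib sum_negf[symmetric] T_def pochhammer_rec[of x]
      using \<open>x \<noteq> 0\<close> by (intro sum.cong) (simp_all add: field_simps del: of_nat_Suc)
    also have "\<dots> = - 1 / of_nat m ^ Suc r"
      unfolding Suc.IH by (simp add: x_def)
    finally show ?case .
  qed
  then show ?thesis
    by (simp add: x_def)
qed

text \<open>Passing from \<open>x = - (m + 1)\<close> to \<open>x + 1\<close> changes
  \<open>(x)_k\<close> by \<open>k (x)_k / x\<close>. The factor \<open>k\<close> cancels the
  denominator, so the increment is the sum evaluated in \<open>sum_pochhammer_mhsum\<close>.\<close>

lemma sum_pochhammer_mhsum_div:
  fixes m n r :: nat
  assumes "m \<le> n"
  shows "(\<Sum>k<n. pochhammer (- of_nat m) (Suc k) / fact (Suc k) * (mhsum (Suc k) (replicate r 1) / of_nat (Suc k))) =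
           (- gharm (r + 1) m :: 'a::field_char_0)"
  using assms
proof (induction m)
  case 0
  show ?case
    by (simp add: pochhammer_0_left)
next
  case (Suc m)
  define x :: 'a where "x = - of_nat (Suc m)"
  define S where "S k = (mhsum (Suc k) (replicate r 1) :: 'a)" for k
  have "x \<noteq> 0"
    unfolding x_def by (simp del: of_nat_Suc)
  have diff: "pochhammer (x + 1) (Suc k) / fact (Suc k) * (S k / of_nat (Suc k)) -
      pochhammer x (Suc k) / fact (Suc k) * (S k / of_nat (Suc k)) =
      pochhammer x (Suc k) / fact (Suc k) * S k / x" for k
  proof -
    have "of_nat (Suc k) \<noteq> (0 :: 'a)"
      by (rule of_nat_neq_0)
    then have nz: "1 + of_nat k \<noteq> (0 :: 'a)"
      by simp
    show ?thesis
      unfolding pochhammer_rec[of x] pochhammer_Suc[of "x + 1"] using nz \<open>x \<noteq> 0\<close>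
      by (simp add: divide_simps) (simp add: algebra_simps)
  qed
  have "(\<Sum>k<n. pochhammer (x + 1) (Suc k) / fact (Suc k) * (S k / of_nat (Suc k))) -
      (\<Sum>k<n. pochhammer x (Suc k) / fact (Suc k) * (S k / of_nat (Suc k))) =
      (\<Sum>k<n. pochhammer x (Suc k) / fact (Suc k) * S k) / x"
    unfolding sum_subtractf[symmetric] diff sum_divide_distrib ..
  also have "\<dots> = 1 / of_nat (Suc m) ^ (r + 1)"
    using sum_pochhammer_mhsum[of "Suc m" n r, where 'a = 'a] Suc.prems
    by (simp add: x_def S_def del: of_nat_Suc)
  also have "x + 1 = - of_nat m"
    by (simp add: x_def)
  also have "(\<Sum>k<n. pochhammer (- of_nat m) (Suc k) / fact (Suc k) * (S k / of_nat (Suc k))) =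
      - gharm (r + 1) m"
    unfolding S_def using Suc by simp
  finally show ?case
    by (simp add: x_def S_def gharm_Suc algebra_simps del: of_nat_Suc fact_Suc)
qed

text \<open>The summation by parts rests on
  \<open>Q (k + 1) - Q k = - m ^ 2 * Q k / (k + 1) ^ 2\<close>, so lowering \<open>r\<close> by one
  gains \<open>1 / m ^ 2\<close>. The boundary term at \<open>n\<close> vanishes with
  \<open>pochhammer (1 - m) n\<close>.\<close>

lemma sum_pochhammer_pochhammer_mhsum:
  fixes m n r :: nat
  assumes "m \<in> {1..n}"
  defines "Q \<equiv> \<lambda>k. pochhammer (1 + of_nat m) k * pochhammer (1 - of_nat m) k / (fact k ^ 2 :: 'a::field_char_0)"
  shows "(\<Sum>k<n. Q k / of_nat (Suc k) ^ 2 * mhsum (Suc k) (replicate r 2)) = 1 / of_nat m ^ (2 * r + 2)"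
proof -
  define x :: 'a where "x = of_nat m"
  have Q: "Q k / of_nat (Suc k) ^ 2 = - (Q (Suc k) - Q k) / x ^ 2" for k
  proof -
    have "of_nat (Suc k) \<noteq> (0 :: 'a)" "x \<noteq> 0"
      using assms by (auto simp: x_def simp del: of_nat_Suc)
    then have nz: "1 + of_nat k \<noteq> (0 :: 'a)" "x \<noteq> 0"
      by simp_all
    then show ?thesis
      unfolding Q_def pochhammer_Suc x_def[symmetric]
      by (simp add: divide_simps power2_eq_square) (simp add: algebra_simps)
  qed
  have "Q n = 0"
    using pochhammer_1_minus_of_nat_eq_0[OF assms(1), where 'a = 'a] by (simp add: Q_def)
  show ?thesis
  proof (induction r)
    case 0
    have "(\<Sum>k<n. Q k / of_nat (Suc k) ^ 2) = - (\<Sum>k<n. Q (Suc k) - Q k) / x ^ 2"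
      unfolding Q by (simp add: sum_divide_distrib flip: sum_negf)
    also have "\<dots> = 1 / x ^ 2"
      unfolding sum_lessThan_telescope \<open>Q n = 0\<close> by (simp add: Q_def)
    finally show ?case
      by (simp add: x_def power2_eq_square del: replicate.simps of_nat_Suc)
  next
    case (Suc r)
    have "(\<Sum>k<n. Q k / of_nat (Suc k) ^ 2 * mhsum (Suc k) (replicate (Suc r) 2)) =
        (- 1 / x ^ 2) * (\<Sum>k<n. (Q (Suc k) - Q k) * mhsum (Suc k) (replicate (Suc r) 2))"
      unfolding Q sum_distrib_left by (intro sum.cong) (simp_all add: divide_simps left_diff_distrib del: replicate.simps)
    also have "(\<Sum>k<n. (Q (Suc k) - Q k) * mhsum (Suc k) (replicate (Suc r) 2)) =
        - (\<Sum>k<n. Q k / of_nat (Suc k) ^ 2 * mhsum (Suc k) (replicate r 2))"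
      using sum_by_parts_lessThan[of Q "\<lambda>k. mhsum k (replicate (Suc r) 2)" n] \<open>Q n = 0\<close>
      by (simp add: mhsum_Suc del: replicate.simps of_nat_Suc)
    finally show ?case
      unfolding Suc.IH by (simp add: x_def power_add ac_simps del: replicate.simps of_nat_Suc) (simp add: power2_eq_square)
  qed
qed

text \<open>For \<open>x = m + 1\<close>, the products at the arguments \<open>1 - x\<close> and
  \<open>- x\<close> share, up to sign, the factor \<open>x (1 + x)_k (1 - x)_k\<close>. The
  remaining linear factors of their difference add up to \<open>2 (k + 1)\<close>, so the increment
  is \<open>2 x\<close> times the previous sum.\<close>

lemma sum_pochhammer_pochhammer_mhsum_div:
  fixes m n r :: nat
  assumes "m \<le> n"
  shows "(\<Sum>k<n. pochhammer (- of_nat m) (Suc k) * pochhammer (1 + of_nat m) (Suc k) / fact (Suc k) ^ 2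
             * (mhsum (Suc k) (replicate r 2) / of_nat (Suc k))) =
           (- 2 * gharm (2 * r + 1) m :: 'a::field_char_0)"
  using assms
proof (induction m)
  case 0
  show ?case
    by (simp add: pochhammer_0_left)
next
  case (Suc m)
  define x :: 'a where "x = of_nat (Suc m)"
  define S where "S k = (mhsum (Suc k) (replicate r 2) :: 'a)" for k
  define Q where "Q k = pochhammer (1 + x) k * pochhammer (1 - x) k / fact k ^ 2" for k
  have diff: "pochhammer (1 - x) (Suc k) * pochhammer x (Suc k) / fact (Suc k) ^ 2 * (S k / of_nat (Suc k)) -
      pochhammer (- x) (Suc k) * pochhammer (1 + x) (Suc k) / fact (Suc k) ^ 2 * (S k / of_nat (Suc k)) =
      2 * x * (Q k / of_nat (Suc k) ^ 2 * S k)" for k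
  proof -
    have "of_nat (Suc k) \<noteq> (0 :: 'a)"
      by (rule of_nat_neq_0)
    then have nz: "1 + of_nat k \<noteq> (0 :: 'a)"
      by simp
    have "pochhammer x (Suc k) = x * pochhammer (1 + x) k" "pochhammer (- x) (Suc k) = - x * pochhammer (1 - x) k"
      by (simp_all add: pochhammer_rec add.commute)
    then show ?thesis
      unfolding Q_def pochhammer_Suc[of "1 + x"] pochhammer_Suc[of "1 - x"] using nz
      by (simp add: divide_simps power2_eq_square) (simp add: algebra_simps)
  qed
  have "(\<Sum>k<n. pochhammer (1 - x) (Suc k) * pochhammer x (Suc k) / fact (Suc k) ^ 2 * (S k / of_nat (Suc k))) -
      (\<Sum>k<n. pochhammer (- x) (Suc k) * pochhammer (1 + x) (Suc k) / fact (Suc k) ^ 2 * (S k / of_nat (Suc k))) =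
      2 * x * (\<Sum>k<n. Q k / of_nat (Suc k) ^ 2 * S k)"
    unfolding sum_subtractf[symmetric] diff sum_distrib_left ..
  also have "\<dots> = 2 / of_nat (Suc m) ^ (2 * r + 1)"
    using sum_pochhammer_pochhammer_mhsum[of "Suc m" n r, where 'a = 'a] Suc.prems
    by (simp add: x_def S_def Q_def del: of_nat_Suc)
  also have "1 - x = - of_nat m"
    by (simp add: x_def)
  also have "(\<Sum>k<n. pochhammer (- of_nat m) (Suc k) * pochhammer x (Suc k) / fact (Suc k) ^ 2 * (S k / of_nat (Suc k))) =
      - 2 * gharm (2 * r + 1) m"
    unfolding S_def using Suc by (simp add: x_def)
  finally show ?case
    by (simp add: x_def S_def gharm_Suc algebra_simps del: of_nat_Suc fact_Suc)
qed

section \<open>Subrings in which the integers below a prime are invertible\<close>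

text \<open>Embedding the ring in a field makes \<open>a / p ^ k\<close> meaningful, so that
  divisibility by \<open>p ^ k\<close> becomes membership in \<open>R\<close>. The argument uses
  only these closure properties; the p-adic integers are substituted at the end.\<close>

locale p_integral =
  fixes R :: "'a::field_char_0 set" and p :: nat
  assumes prime_p: "prime p"
    and p_gt_3: "p > 3"
    and one_closed [simp, intro]: "1 \<in> R"
    and diff_closed [intro]: "a \<in> R \<Longrightarrow> b \<in> R \<Longrightarrow> a - b \<in> R"
    and mult_closed [intro]: "a \<in> R \<Longrightarrow> b \<in> R \<Longrightarrow> a * b \<in> R"
    and inverse_of_nat_closed: "0 < j \<Longrightarrow> j < p \<Longrightarrow> 1 / of_nat j \<in> R"
begin

lemma zero_closed [simp, intro]: "0 \<in> R"
  using diff_closed[of 1 1] by simp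

lemma uminus_closed [intro]: "a \<in> R \<Longrightarrow> - a \<in> R"
  using diff_closed[of 0 a] by simp

lemma add_closed [intro]: "a \<in> R \<Longrightarrow> b \<in> R \<Longrightarrow> a + b \<in> R"
  using diff_closed[of a "- b"] by auto

lemma of_nat_closed [simp, intro]: "of_nat n \<in> R"
  by (induction n) (auto simp del: of_nat_add)

lemma numeral_closed [simp, intro]: "numeral n \<in> R"
  using of_nat_closed[of "numeral n"] by simp

lemma power_closed [intro]: "a \<in> R \<Longrightarrow> a ^ n \<in> R"
  by (induction n) auto

lemma sum_closed [intro]: "(\<And>i. i \<in> I \<Longrightarrow> f i \<in> R) \<Longrightarrow> sum f I \<in> R"
  by (induction I rule: infinite_finite_induct) auto

lemma divide_of_nat_closed [intro]: "a \<in> R \<Longrightarrow> 0 < j \<Longrightarrow> j < p \<Longrightarrow> a / of_nat j \<in> R"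
  using mult_closed[OF _ inverse_of_nat_closed[of j], of a] by simp

lemma divide_2_closed [intro]: "a \<in> R \<Longrightarrow> a / 2 \<in> R"
  using divide_of_nat_closed[of a 2] p_gt_3 by simp

lemma p_pos [simp]: "p > 0"
  using p_gt_3 by simp

lemma p_neq_0 [simp]: "p \<noteq> 0"
  using p_gt_3 by simp

lemma odd_p: "odd p"
  using prime_odd_nat[OF prime_p] p_gt_3 by simp

lemma divide_fact_closed: "a \<in> R \<Longrightarrow> k < p \<Longrightarrow> a / fact k \<in> R"
proof (induction k)
  case (Suc k)
  then have "a / fact k / of_nat (Suc k) \<in> R"
    by (intro divide_of_nat_closed) auto
  then show ?case
    by (simp add: mult.commute)
qed auto

lemma gharm_closed: "n < p \<Longrightarrow> gharm t n \<in> R"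
proof (induction n)
  case (Suc n)
  have "(1 / of_nat (Suc n)) ^ t \<in> R"
    using Suc.prems by (intro power_closed inverse_of_nat_closed) auto
  then show ?case
    using Suc by (auto simp: gharm_Suc power_divide simp del: of_nat_Suc)
qed auto

lemma mhsum_closed: "n < p \<Longrightarrow> mhsum n (replicate r t) \<in> R"
proof (induction n arbitrary: r)
  case 0
  show ?case
    by (cases r) (auto simp del: replicate.simps)
next
  case (Suc n)
  note IH = Suc.IH
  show ?case
  proof (induction r)
    case (Suc r)
    have "(1 / of_nat (Suc n)) ^ t \<in> R"
      using \<open>Suc n < p\<close> by (intro power_closed inverse_of_nat_closed) auto
    then have "mhsum (Suc n) (replicate r t) * (1 / of_nat (Suc n)) ^ t \<in> R"
      using Suc.IH by blast
    then show ?case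
      using IH[of "Suc r"] \<open>Suc n < p\<close> by (auto simp: mhsum_Suc power_divide simp del: of_nat_Suc replicate.simps)
  qed (auto simp del: replicate.simps)
qed

section \<open>Congruences modulo powers of \<open>p\<close>\<close>

definition cg :: "nat \<Rightarrow> 'a \<Rightarrow> 'a \<Rightarrow> bool" where
  "cg k a b \<longleftrightarrow> (a - b) / of_nat p ^ k \<in> R"

lemma cg_0_0: "cg k a 0 \<longleftrightarrow> a / of_nat p ^ k \<in> R"
  by (simp add: cg_def)

lemma cg_refl [simp, intro]: "cg k a a"
  by (simp add: cg_def)

lemma cg_add: "cg k a b \<Longrightarrow> cg k c d \<Longrightarrow> cg k (a + c) (b + d)"
  unfolding cg_def using add_closed[of "(a - b) / of_nat p ^ k" "(c - d) / of_nat p ^ k"]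
  by (simp add: diff_divide_distrib add_divide_distrib algebra_simps)

lemma cg_mult_left: "c \<in> R \<Longrightarrow> cg k a b \<Longrightarrow> cg k (c * a) (c * b)"
  unfolding cg_def using mult_closed[of c "(a - b) / of_nat p ^ k"] by (simp add: right_diff_distrib)

lemma cg_uminus: "cg k a b \<Longrightarrow> cg k (- a) (- b)"
  using cg_mult_left[of "- 1" k a b] by auto

lemma cg_diff: "cg k a b \<Longrightarrow> cg k c d \<Longrightarrow> cg k (a - c) (b - d)"
  using cg_add[of k a b "- c" "- d"] cg_uminus by simp

lemma cg_sym: "cg k a b \<Longrightarrow> cg k b a"
  using cg_uminus[of k a b] by (simp add: cg_def)

lemma cg_trans [trans]: "cg k a b \<Longrightarrow> cg k b c \<Longrightarrow> cg k a c"
  using cg_add[of k a b b c] by (simp add: cg_def)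

lemma cg_sum: "(\<And>i. i \<in> I \<Longrightarrow> cg k (f i) (g i)) \<Longrightarrow> cg k (sum f I) (sum g I)"
  by (induction I rule: infinite_finite_induct) (auto intro: cg_add)

text \<open>\<open>cg\<close> relates arbitrary field elements and does not make them integral, so
  the multipliers \<open>a\<close> of the second congruence and \<open>d\<close> of the first must
  be known to lie in \<open>R\<close>.\<close>

lemma cg_mult: "cg k a b \<Longrightarrow> cg k c d \<Longrightarrow> a \<in> R \<Longrightarrow> d \<in> R \<Longrightarrow> cg k (a * c) (b * d)"
  using cg_mult_left[of a k c d] cg_mult_left[of d k a b] cg_trans[of k "a * c" "a * d" "b * d"]
  by (simp add: mult.commute)

text \<open>This converts between Taylor terms, which carry powers of \<open>p\<close>, and the
  derivatives themselves modulo lower powers.\<close>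

lemma cg_p_power_mult_iff: "cg (j + k) (of_nat p ^ j * a) (of_nat p ^ j * b) \<longleftrightarrow> cg k a b"
  by (simp add: cg_def power_add flip: right_diff_distrib)

lemma cg_le: "cg k a b \<Longrightarrow> j \<le> k \<Longrightarrow> cg j a b"
proof -
  assume "cg k a b" "j \<le> k"
  then have "(a - b) / of_nat p ^ k * of_nat p ^ (k - j) \<in> R"
    unfolding cg_def by blast
  then show ?thesis
    using \<open>j \<le> k\<close> by (simp add: cg_def power_diff)
qed

lemma cg_closed:
  assumes "cg k a b"
  shows "a \<in> R \<longleftrightarrow> b \<in> R"
proof -
  have "a - b \<in> R"
    using cg_le[OF assms, of 0] by (simp add: cg_def)
  then show ?thesis
    using add_closed[of "a - b" b] diff_closed[of a "a - b"] by auto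
qed

lemma cg_p_power_0: "a \<in> R \<Longrightarrow> cg k (of_nat p ^ k * a) 0"
  by (simp add: cg_def)

lemma cg_fermat:
  assumes "0 < j" "j < p"
  shows "cg 1 (of_nat j ^ (p - 1)) 1"
proof -
  have "\<not> p dvd j"
    using assms nat_dvd_not_less by blast
  then have "[j ^ (p - 1) = 1] (mod p)"
    using fermat_theorem[OF prime_p] by blast
  then have "p dvd j ^ (p - 1) - 1"
    using assms by (subst cong_altdef_nat[symmetric]) (auto simp: Suc_le_eq)
  then obtain q where "j ^ (p - 1) - 1 = p * q"
    by blast
  then have q: "j ^ (p - 1) = p * q + 1"
    using assms by (metis One_nat_def Suc_leI le_add_diff_inverse2 zero_less_power)
  show ?thesis
    unfolding cg_def of_nat_power[symmetric] q by simp
qed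

subsection \<open>Polynomials\<close>

definition Rpoly :: "'a poly \<Rightarrow> bool" where
  "Rpoly f \<longleftrightarrow> (\<forall>i. coeff f i \<in> R)"

lemma Rpoly_0 [simp, intro]: "Rpoly 0"
  by (simp add: Rpoly_def)

lemma Rpoly_pCons [simp]: "Rpoly (pCons c f) \<longleftrightarrow> c \<in> R \<and> Rpoly f"
  unfolding Rpoly_def by (metis coeff_pCons_0 coeff_pCons_Suc not0_implies_Suc)

lemma Rpoly_1 [simp, intro]: "Rpoly 1"
  by (simp add: one_pCons)

lemma Rpoly_add [intro]: "Rpoly f \<Longrightarrow> Rpoly g \<Longrightarrow> Rpoly (f + g)"
  by (auto simp: Rpoly_def)

lemma Rpoly_diff [intro]: "Rpoly f \<Longrightarrow> Rpoly g \<Longrightarrow> Rpoly (f - g)"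
  by (auto simp: Rpoly_def)

lemma Rpoly_smult [intro]: "c \<in> R \<Longrightarrow> Rpoly f \<Longrightarrow> Rpoly (smult c f)"
  by (auto simp: Rpoly_def)

lemma Rpoly_mult [intro]: "Rpoly f \<Longrightarrow> Rpoly g \<Longrightarrow> Rpoly (f * g)"
  by (auto simp: Rpoly_def coeff_mult)

lemma Rpoly_sum [intro]: "(\<And>i. i \<in> I \<Longrightarrow> Rpoly (f i)) \<Longrightarrow> Rpoly (sum f I)"
  by (induction I rule: infinite_finite_induct) auto

lemma Rpoly_prod [intro]: "(\<And>i. i \<in> I \<Longrightarrow> Rpoly (f i)) \<Longrightarrow> Rpoly (prod f I)"
  by (induction I rule: infinite_finite_induct) auto

lemma Rpoly_pderiv [intro]: "Rpoly f \<Longrightarrow> Rpoly (pderiv f)"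
  by (auto simp: Rpoly_def coeff_pderiv simp del: of_nat_Suc)

lemma Rpoly_pcompose [intro]: "Rpoly f \<Longrightarrow> Rpoly g \<Longrightarrow> Rpoly (pcompose f g)"
  by (induction f) (auto simp: pcompose_pCons)

lemma poly_closed [intro]: "Rpoly f \<Longrightarrow> a \<in> R \<Longrightarrow> poly f a \<in> R"
  by (induction f) auto

lemma Rpoly_synthetic_div: "Rpoly f \<Longrightarrow> a \<in> R \<Longrightarrow> Rpoly (synthetic_div f a)"
  by (induction f) auto

lemma poly_taylor:
  assumes "Rpoly f" "a \<in> R" "h \<in> R"
  shows "\<exists>w\<in>R. poly f (a + h) =
      poly f a + h * poly (pderiv f) a + h ^ 2 / 2 * poly (pderiv (pderiv f)) a + h ^ 3 * w"
  using assms(1)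
proof (induction f)
  case (pCons c f)
  then obtain w where w: "w \<in> R" "poly f (a + h) =
      poly f a + h * poly (pderiv f) a + h ^ 2 / 2 * poly (pderiv (pderiv f)) a + h ^ 3 * w"
    by auto
  have "poly (pCons c f) (a + h) = poly (pCons c f) a + h * poly (pderiv (pCons c f)) a
      + h ^ 2 / 2 * poly (pderiv (pderiv (pCons c f))) a
      + h ^ 3 * (poly (pderiv (pderiv f)) a / 2 + a * w + h * w)"
    by (simp add: pderiv_pCons pderiv_add w(2) field_simps power2_eq_square power3_eq_cube)
  moreover have "poly (pderiv (pderiv f)) a / 2 + a * w + h * w \<in> R"
    using assms pCons.prems w(1)
    by (intro add_closed divide_2_closed mult_closed poly_closed Rpoly_pderiv) simp_all
  ultimately show ?case
    by blast
qed auto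

lemma cg_taylor3:
  assumes "Rpoly f" "a \<in> R" "c \<in> R"
  shows "cg 3 (poly f (a + of_nat p * c)) (poly f a + of_nat p * c * poly (pderiv f) a
           + of_nat p ^ 2 * c ^ 2 / 2 * poly (pderiv (pderiv f)) a)"
proof -
  obtain w where "w \<in> R" and w: "poly f (a + of_nat p * c) = poly f a + of_nat p * c * poly (pderiv f) a
      + (of_nat p * c) ^ 2 / 2 * poly (pderiv (pderiv f)) a + (of_nat p * c) ^ 3 * w"
    using poly_taylor[of f a "of_nat p * c"] assms by auto
  have "c ^ 3 * w \<in> R"
    using assms \<open>w \<in> R\<close> by auto
  then show ?thesis
    by (simp add: cg_def w power_mult_distrib)
qed

lemma cg_taylor2:
  assumes "Rpoly f" "a \<in> R" "c \<in> R"
  shows "cg 2 (poly f (a + of_nat p * c)) (poly f a + of_nat p * c * poly (pderiv f) a)"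
proof -
  have "c ^ 2 / 2 * poly (pderiv (pderiv f)) a \<in> R"
    using assms by (intro mult_closed divide_2_closed power_closed poly_closed Rpoly_pderiv)
  from cg_p_power_0[OF this, of 2] have "cg 2 (of_nat p ^ 2 * c ^ 2 / 2 * poly (pderiv (pderiv f)) a) 0"
    by (simp add: mult.assoc)
  from cg_add[OF cg_refl this, of "poly f a + of_nat p * c * poly (pderiv f) a"] cg_le[OF cg_taylor3[OF assms], of 2]
  show ?thesis
    by (auto intro: cg_trans)
qed

section \<open>Congruence of polynomials modulo \<open>p\<close> and interpolation\<close>

definition pcg :: "'a poly \<Rightarrow> 'a poly \<Rightarrow> bool" where
  "pcg f g \<longleftrightarrow> Rpoly (smult (1 / of_nat p) (f - g))"

text \<open>This is why \<open>pcg\<close> compares coefficients: agreement of values does not pass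
  to derivatives, as \<open>X ^ p - X\<close> shows at the residues.\<close>

lemma pcg_pderiv: "pcg f g \<Longrightarrow> pcg (pderiv f) (pderiv g)"
  unfolding pcg_def pderiv_diff[symmetric] pderiv_smult[symmetric] by blast

lemma pcg_poly: "pcg f g \<Longrightarrow> a \<in> R \<Longrightarrow> cg 1 (poly f a) (poly g a)"
  unfolding pcg_def cg_def using poly_closed[of "smult (1 / of_nat p) (f - g)" a] by simp

text \<open>Lagrange's bound on the number of roots, modulo \<open>p\<close>. Invertible differences
  replace distinctness in a field: after \<open>X - a\<close> is split off, the quotient still
  vanishes modulo \<open>p\<close> at the other points because \<open>b - a\<close> can be divided
  out.\<close>

lemma Rpoly_divide_p_if_simple_roots:
  assumes "finite A" "A \<subseteq> R" "\<And>a b. a \<in> A \<Longrightarrow> b \<in> A \<Longrightarrow> a \<noteq> b \<Longrightarrow> 1 / (a - b) \<in> R"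
    and "Rpoly f" "degree f < card A" "\<And>a. a \<in> A \<Longrightarrow> cg 1 (poly f a) 0"
  shows "Rpoly (smult (1 / of_nat p) f)"
  using assms
proof (induction A arbitrary: f rule: finite_induct)
  case (insert a A)
  define g where "g = synthetic_div f a"
  have f: "f = [:- a, 1:] * g + [:poly f a:]"
    unfolding g_def by (rule synthetic_div_correct'[symmetric])
  have fa: "poly f a / of_nat p \<in> R"
    using insert.prems(5)[of a] by (simp add: cg_def)
  have "Rpoly (smult (1 / of_nat p) g)"
  proof (cases "degree f = 0")
    case True
    then have "g = 0"
      by (simp add: g_def synthetic_div_eq_0_iff)
    then show ?thesis
      by simp
  next
    case False
    show ?thesis
    proof (rule insert.IH)
      show "Rpoly g"
        using insert.prems by (auto simp: g_def intro: Rpoly_synthetic_div)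
      show "degree g < card A"
        using insert.prems(4) insert.hyps False by (simp add: g_def degree_synthetic_div)
      show "cg 1 (poly g b) 0" if b: "b \<in> A" for b
      proof -
        have "b \<noteq> a"
          using insert.hyps b by auto
        have "poly f b = (b - a) * poly g b + poly f a"
          using arg_cong[OF f, of "\<lambda>f. poly f b"] by (simp add: algebra_simps)
        then have "poly g b = 1 / (b - a) * (poly f b - poly f a)"
          using \<open>b \<noteq> a\<close> by simp
        moreover have "cg 1 (1 / (b - a) * (poly f b - poly f a)) (1 / (b - a) * (0 - 0))"
          using insert.prems b \<open>b \<noteq> a\<close> by (intro cg_mult_left cg_diff) auto
        ultimately show ?thesis
          by simp
      qed
    qed (use insert.prems in auto)
  qed
  then have "Rpoly ([:- a, 1:] * smult (1 / of_nat p) g + [:poly f a / of_nat p:])"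
    using fa insert.prems by (intro Rpoly_add Rpoly_mult) auto
  also have "[:- a, 1:] * smult (1 / of_nat p) g + [:poly f a / of_nat p:] =
      smult (1 / of_nat p) ([:- a, 1:] * g + [:poly f a:])"
    by (simp add: smult_add_right)
  finally show ?case
    by (simp only: f[symmetric])
qed auto

text \<open>Uniqueness of Hermite interpolation modulo \<open>p\<close>. Each point permits two
  divisions by \<open>X - a\<close>, with remainders \<open>f(a)\<close> and
  \<open>g(a) = f'(a)\<close>, both divisible by \<open>p\<close>.\<close>

lemma Rpoly_divide_p_if_double_roots:
  assumes "finite A" "A \<subseteq> R" "\<And>a b. a \<in> A \<Longrightarrow> b \<in> A \<Longrightarrow> a \<noteq> b \<Longrightarrow> 1 / (a - b) \<in> R"
    and "Rpoly f" "degree f < 2 * card A"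
    and "\<And>a. a \<in> A \<Longrightarrow> cg 1 (poly f a) 0" "\<And>a. a \<in> A \<Longrightarrow> cg 1 (poly (pderiv f) a) 0"
  shows "Rpoly (smult (1 / of_nat p) f)"
  using assms
proof (induction A arbitrary: f rule: finite_induct)
  case (insert a A)
  define g where "g = synthetic_div f a"
  define h where "h = synthetic_div g a"
  have f: "f = [:- a, 1:] * g + [:poly f a:]"
    unfolding g_def by (rule synthetic_div_correct'[symmetric])
  have g: "g = [:- a, 1:] * h + [:poly g a:]"
    unfolding h_def by (rule synthetic_div_correct'[symmetric])
  have f': "pderiv f = [:- a, 1:] * pderiv g + g"
    using arg_cong[OF f, of pderiv] by (simp add: pderiv_add pderiv_diff pderiv_smult pderiv_pCons)
  have g': "pderiv g = [:- a, 1:] * pderiv h + h"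
    using arg_cong[OF g, of pderiv] by (simp add: pderiv_add pderiv_diff pderiv_smult pderiv_pCons)
  have fa: "cg 1 (poly f a) 0"
    using insert.prems(5)[of a] by simp
  have ga: "cg 1 (poly g a) 0"
    using insert.prems(6)[of a] arg_cong[OF f', of "\<lambda>f. poly f a"] by simp
  have "Rpoly (smult (1 / of_nat p) h)"
  proof (cases "degree f < 2")
    case True
    then have "h = 0"
      by (simp add: h_def synthetic_div_eq_0_iff g_def degree_synthetic_div)
    then show ?thesis
      by simp
  next
    case False
    show ?thesis
    proof (rule insert.IH)
      show "Rpoly h"
        using insert.prems by (auto simp: h_def g_def intro: Rpoly_synthetic_div)
      show "degree h < 2 * card A"
        using insert.prems(4) insert.hyps False by (simp add: h_def g_def degree_synthetic_div)
      fix b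
      assume b: "b \<in> A"
      then have "b \<noteq> a"
        using insert.hyps by auto
      have bR: "1 / (b - a) \<in> R" "b \<in> R"
        using insert.prems b \<open>b \<noteq> a\<close> by auto
      have gb: "cg 1 (poly g b) 0"
      proof -
        have "poly f b = (b - a) * poly g b + poly f a"
          using arg_cong[OF f, of "\<lambda>f. poly f b"] by (simp add: algebra_simps)
        then have "poly g b = 1 / (b - a) * (poly f b - poly f a)"
          using \<open>b \<noteq> a\<close> by simp
        moreover have "cg 1 (1 / (b - a) * (poly f b - poly f a)) (1 / (b - a) * (0 - 0))"
          using bR insert.prems(5)[of b] b fa by (intro cg_mult_left cg_diff) auto
        ultimately show ?thesis
          by simp
      qed
      show hb: "cg 1 (poly h b) 0"
      proof -
        have "poly g b = (b - a) * poly h b + poly g a"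
          using arg_cong[OF g, of "\<lambda>f. poly f b"] by (simp add: algebra_simps)
        then have "poly h b = 1 / (b - a) * (poly g b - poly g a)"
          using \<open>b \<noteq> a\<close> by simp
        moreover have "cg 1 (1 / (b - a) * (poly g b - poly g a)) (1 / (b - a) * (0 - 0))"
          using bR gb ga by (intro cg_mult_left cg_diff) auto
        ultimately show ?thesis
          by simp
      qed
      show "cg 1 (poly (pderiv h) b) 0"
      proof -
        have "poly (pderiv f) b = (b - a) * ((b - a) * poly (pderiv h) b + poly h b) + poly g b"
          using arg_cong[OF f', of "\<lambda>f. poly f b"] arg_cong[OF g', of "\<lambda>f. poly f b"] by (simp add: algebra_simps)
        then have "poly (pderiv h) b = 1 / (b - a) * (1 / (b - a) * (poly (pderiv f) b - poly g b) - poly h b)"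
          using \<open>b \<noteq> a\<close> by simp
        moreover have "cg 1 (1 / (b - a) * (1 / (b - a) * (poly (pderiv f) b - poly g b) - poly h b))
            (1 / (b - a) * (1 / (b - a) * (0 - 0) - 0))"
          using bR gb hb insert.prems(6)[of b] b by (intro cg_mult_left cg_diff) auto
        ultimately show ?thesis
          by simp
      qed
    qed (use insert.prems in auto)
  qed
  then have "Rpoly ([:- a, 1:] * ([:- a, 1:] * smult (1 / of_nat p) h + [:poly g a / of_nat p:]) + [:poly f a / of_nat p:])"
    using fa ga insert.prems by (intro Rpoly_add Rpoly_mult) (auto simp: cg_def)
  also have "[:- a, 1:] * ([:- a, 1:] * smult (1 / of_nat p) h + [:poly g a / of_nat p:]) + [:poly f a / of_nat p:] =
      smult (1 / of_nat p) ([:- a, 1:] * ([:- a, 1:] * h + [:poly g a:]) + [:poly f a:])"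
    by (simp add: smult_add_right smult_diff_right)
  finally show ?case
    by (simp only: f[symmetric] g[symmetric])
qed auto

lemma cg_poly_add_p_mult:
  assumes "Rpoly f" "a \<in> R" "c \<in> R"
  shows "cg 1 (poly f (a + of_nat p * c)) (poly f a)"
proof -
  have "c * poly (pderiv f) a \<in> R"
    using assms by (intro mult_closed poly_closed Rpoly_pderiv)
  from cg_p_power_0[OF this, of 1] have "cg 1 (of_nat p * c * poly (pderiv f) a) 0"
    by (simp add: mult.assoc)
  from cg_add[OF cg_refl this, of "poly f a"] cg_le[OF cg_taylor2[OF assms], of 1]
  show ?thesis
    by (auto intro: cg_trans)
qed

subsection \<open>Bernoulli polynomials modulo p\<close>

lemma bernpoly_0_closed: "n + 2 \<le> p \<Longrightarrow> bernpoly n 0 \<in> R"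
proof (induction n rule: less_induct)
  case (less n)
  show ?case
  proof (cases n)
    case (Suc k)
    have "of_nat (Suc (Suc k)) * bernpoly (Suc k) 0 \<in> R"
      unfolding bernpoly_0_recurrence using less Suc
      by (intro uminus_closed sum_closed mult_closed of_nat_closed) auto
    then have "of_nat (Suc (Suc k)) * bernpoly (Suc k) 0 / of_nat (Suc (Suc k)) \<in> R"
      using less.prems Suc by (intro divide_of_nat_closed) auto
    then show ?thesis
      using Suc by (simp del: of_nat_Suc)
  qed (simp add: bernpoly_0_0)
qed

lemma Rpoly_bern_poly: "n + 2 \<le> p \<Longrightarrow> Rpoly (bern_poly n)"
  by (auto simp: Rpoly_def coeff_bern_poly intro!: mult_closed bernpoly_0_closed)

text \<open>Faulhaber's polynomial, reflected: \<open>1 - X\<close> sends \<open>- m\<close> to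
  \<open>1 + m\<close>, the constant makes the value at 0 vanish, and the sign fits the values
  \<open>- gharm e m\<close> of the sums in question.\<close>

definition power_sum_poly :: "nat \<Rightarrow> 'a poly" where
  "power_sum_poly n =
     smult (- 1 / of_nat (Suc n)) (pcompose (bern_poly (Suc n) - [:bernpoly (Suc n) 1:]) [:1, - 1:])"

lemma Rpoly_power_sum_poly:
  assumes "n > 0" "n + 2 \<le> p"
  shows "Rpoly (power_sum_poly n)"
proof -
  \<comment> \<open>\<open>bernpoly (Suc n) 0\<close> need not be integral when \<open>n + 2 = p\<close>, but it cancels.\<close>
  have "coeff (bern_poly (Suc n) - [:bernpoly (Suc n) 1:]) i \<in> R" for i
    using assms
    by (cases i) (auto simp: coeff_bern_poly bernpoly_1 simp del: binomial_Suc_Suc intro!: mult_closed bernpoly_0_closed)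
  then have "Rpoly (bern_poly (Suc n) - [:bernpoly (Suc n) 1:])"
    by (simp add: Rpoly_def)
  then show ?thesis
    unfolding power_sum_poly_def using assms
    by (intro Rpoly_smult Rpoly_pcompose divide_of_nat_closed) (auto intro: uminus_closed)
qed

lemma degree_power_sum_poly: "degree (power_sum_poly n) \<le> Suc n"
  unfolding power_sum_poly_def
  by (auto simp: degree_pcompose intro!: order.trans[OF degree_smult_le] degree_diff_le degree_bern_poly)

lemma pderiv_power_sum_poly: "pderiv (power_sum_poly n) = pcompose (bern_poly n) [:1, - 1:]"
  unfolding power_sum_poly_def pderiv_smult pderiv_pcompose pderiv_diff pderiv_bern_poly
  by (simp add: pderiv_pCons pcompose_smult del: of_nat_Suc)

lemma poly_power_sum_poly: "poly (power_sum_poly n) (- of_nat m) = - (\<Sum>j=1..m. of_nat j ^ n)"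
proof -
  have "poly (power_sum_poly n) (- of_nat m) = - (bernpoly (Suc n) (1 + of_nat m) - bernpoly (Suc n) 1) / of_nat (Suc n)"
    by (simp add: power_sum_poly_def poly_pcompose diff_divide_distrib del: of_nat_Suc)
  then show ?thesis
    unfolding bernpoly_sum_powers by (simp del: of_nat_Suc)
qed

section \<open>Power sums and harmonic numbers modulo \<open>p\<close>\<close>

lemma cg_power_inverse:
  assumes "n + e = p - 1" "0 < j" "j < p"
  shows "cg 1 (of_nat j ^ n) (1 / of_nat j ^ e)"
proof -
  have "(1 / of_nat j) ^ e \<in> R"
    using assms by (intro power_closed inverse_of_nat_closed)
  from cg_mult_left[OF this cg_fermat[OF assms(2,3)]]
  have "cg 1 ((1 / of_nat j) ^ e * of_nat j ^ (n + e)) ((1 / of_nat j) ^ e * 1)"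
    using assms(1) by simp
  moreover have "(1 / of_nat j) ^ e * of_nat j ^ (n + e) = (of_nat j ^ n :: 'a)"
    using assms(2) by (simp add: power_divide power_add)
  ultimately show ?thesis
    by (simp add: power_divide)
qed

lemma cg_sum_powers: "n + e = p - 1 \<Longrightarrow> m < p \<Longrightarrow> cg 1 (\<Sum>j=1..m. of_nat j ^ n) (gharm e m)"
  unfolding gharm_def by (intro cg_sum cg_power_inverse) auto

lemma cg_poly_power_sum_poly:
  "n + e = p - 1 \<Longrightarrow> m < p \<Longrightarrow> cg 1 (poly (power_sum_poly n) (- of_nat m)) (- gharm e m)"
  unfolding poly_power_sum_poly by (intro cg_uminus cg_sum_powers)

text \<open>The power sum polynomial vanishes at 1 because \<open>B_(n+1)(0) = B_(n+1)(1)\<close>,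
  and \<open>1\<close> and \<open>- (p - 1)\<close> differ by \<open>p\<close>.\<close>

lemma gharm_p_minus_1_cg_0:
  assumes "e > 0" "e + 2 \<le> p"
  shows "cg 1 (gharm e (p - 1)) 0"
proof -
  define n where "n = p - 1 - e"
  have n: "n + e = p - 1" "n > 0" "n + 2 \<le> p"
    using assms by (auto simp: n_def)
  have "poly (power_sum_poly n) 1 = 0"
    using n by (simp add: power_sum_poly_def poly_pcompose bernpoly_1)
  moreover have "1 + of_nat p * (- 1) = (- of_nat (p - 1) :: 'a)"
    by (simp add: of_nat_diff Suc_le_eq)
  ultimately have "cg 1 (poly (power_sum_poly n) (- of_nat (p - 1))) 0"
    using cg_poly_add_p_mult[OF Rpoly_power_sum_poly[OF n(2,3)], of 1 "- 1"] by auto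
  moreover have "cg 1 (poly (power_sum_poly n) (- of_nat (p - 1))) (- gharm e (p - 1))"
    using n by (intro cg_poly_power_sum_poly) auto
  ultimately have "cg 1 (- gharm e (p - 1)) 0"
    using cg_sym cg_trans by blast
  then show ?thesis
    using cg_uminus by fastforce
qed

subsection \<open>The first congruence\<close>

lemma card_residues: "card ((\<lambda>m. - of_nat m :: 'a) ` {..<p}) = p"
  by (subst card_image) (auto simp: inj_on_def)

lemma residues_diff:
  assumes "a \<in> (\<lambda>m. - of_nat m) ` {..<p}" "b \<in> (\<lambda>m. - of_nat m) ` {..<p}" "a \<noteq> b"
  shows "1 / (a - b) \<in> R"
proof -
  obtain k l where kl: "a = - of_nat k" "b = - of_nat l" "k < p" "l < p" "k \<noteq> l"
    using assms by auto
  show ?thesis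
  proof (cases "k < l")
    case True
    then show ?thesis
      using kl inverse_of_nat_closed[of "l - k"] by (simp add: of_nat_diff)
  next
    case False
    then have "- (1 / of_nat (k - l)) \<in> R"
      using kl by (intro uminus_closed inverse_of_nat_closed) auto
    then show ?thesis
      using kl False by (simp add: of_nat_diff minus_divide_right)
  qed
qed

definition poly1 :: "nat \<Rightarrow> 'a poly" where
  "poly1 r = (\<Sum>k<p-1. smult (mhsum (Suc k) (replicate r 1) / of_nat (Suc k) / fact (Suc k)) (\<Prod>i\<le>k. [:of_nat i, 1:]))"

lemma poly_poly1:
  "poly (poly1 r) x = (\<Sum>k<p-1. pochhammer x (Suc k) / fact (Suc k) * (mhsum (Suc k) (replicate r 1) / of_nat (Suc k)))"
  unfolding poly1_def poly_sum poly_smult poly_prod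
  by (intro sum.cong) (simp_all add: pochhammer_prod atLeast0_lessThan_Suc atLeast0LessThan lessThan_Suc_atMost ac_simps del: fact_Suc of_nat_Suc)

lemma Rpoly_poly1: "Rpoly (poly1 r)"
  unfolding poly1_def
  by (intro Rpoly_sum Rpoly_smult Rpoly_prod divide_fact_closed divide_of_nat_closed mhsum_closed) auto

lemma degree_poly1: "degree (poly1 r) \<le> p - 1"
proof -
  have "degree (\<Prod>i\<le>k. [:of_nat i, 1::'a:]) \<le> Suc k" for k
    using degree_prod_sum_le[of "{..k}" "\<lambda>i. [:of_nat i, 1::'a:]"] by simp
  then show ?thesis
    unfolding poly1_def
    by (intro degree_sum_le order.trans[OF degree_smult_le] order.trans[OF \<open>\<And>k. degree _ \<le> Suc k\<close>]) auto
qed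

lemma poly1_eval: "m < p \<Longrightarrow> poly (poly1 r) (- of_nat m) = - gharm (r + 1) m"
  unfolding poly_poly1 by (rule sum_pochhammer_mhsum_div) auto

text \<open>Both polynomials have degree below \<open>p\<close> and agree modulo \<open>p\<close> at
  the \<open>p\<close> residues \<open>- m\<close>; \<open>n\<close> is chosen so that
  \<open>j ^ n\<close> stands for \<open>1 / j ^ (r + 1)\<close>.\<close>

lemma pcg_poly1:
  assumes "n + r + 1 = p - 1" "n > 0"
  shows "pcg (poly1 r) (power_sum_poly n)"
  unfolding pcg_def
proof (rule Rpoly_divide_p_if_simple_roots[where A = "(\<lambda>m. - of_nat m) ` {..<p}"])
  show "Rpoly (poly1 r - power_sum_poly n)"
    using assms by (intro Rpoly_diff Rpoly_poly1 Rpoly_power_sum_poly) auto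
  show "degree (poly1 r - power_sum_poly n) < card ((\<lambda>m. - of_nat m :: 'a) ` {..<p})"
  proof -
    have "degree (poly1 r - power_sum_poly n) \<le> p - 1"
      using assms degree_power_sum_poly[of n] by (intro degree_diff_le degree_poly1) auto
    then show ?thesis
      unfolding card_residues using p_pos by linarith
  qed
  fix a :: 'a
  assume "a \<in> (\<lambda>m. - of_nat m) ` {..<p}"
  then obtain m where m: "a = - of_nat m" "m < p"
    by auto
  have "cg 1 (- gharm (r + 1) m - poly (power_sum_poly n) (- of_nat m)) (- gharm (r + 1) m - (- gharm (r + 1) m))"
    using assms m by (intro cg_diff cg_refl cg_poly_power_sum_poly) auto
  then show "cg 1 (poly (poly1 r - power_sum_poly n) a) 0"
    using m by (simp add: poly1_eval del: replicate.simps)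
qed (auto intro: residues_diff)

lemma cg_poly1:
  assumes "r + 3 < p" "m < p" "s \<in> R" "X \<in> R" "X = - of_nat m + of_nat p * s"
  shows "cg 2 (poly (poly1 r) X) (- gharm (r + 1) m - (- 1) ^ r * s * of_nat p * bernpoly (p - r - 2) X)"
proof -
  define n where "n = p - r - 2"
  have n: "n + r + 1 = p - 1" "n > 0" "n + 2 \<le> p"
    using assms by (auto simp: n_def)
  have "p = n + r + 2"
    using n p_gt_3 by linarith
  \<comment> \<open>The parity of \<open>n + r = p - 2\<close> gives the sign produced by reflecting
    \<open>B_n\<close>.\<close>
  then have "odd (n + r)"
    using odd_p by simp
  then have "(- 1) ^ n = (- ((- 1) ^ r) :: 'a)"
    by (auto simp: minus_one_power_iff)
  then have d: "poly (pderiv (power_sum_poly n)) X = - ((- 1) ^ r * bernpoly n X)"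
    by (simp add: pderiv_power_sum_poly poly_pcompose bernpoly_reflect)
  \<comment> \<open>Expanding around \<open>X\<close> rather than \<open>- m\<close> puts the
    derivative, and so the Bernoulli polynomial, at \<open>X\<close> itself.\<close>
  have "cg 2 (poly (poly1 r) (X + of_nat p * (- s))) (poly (poly1 r) X + of_nat p * (- s) * poly (pderiv (poly1 r)) X)"
    using assms by (intro cg_taylor2 Rpoly_poly1) auto
  moreover have "X + of_nat p * (- s) = - of_nat m"
    using assms by simp
  ultimately have 1: "cg 2 (- gharm (r + 1) m) (poly (poly1 r) X + of_nat p * (- s) * poly (pderiv (poly1 r)) X)"
    using assms by (simp only: poly1_eval)
  have "cg 1 (poly (pderiv (poly1 r)) X) (- ((- 1) ^ r * bernpoly n X))"
    unfolding d[symmetric] using pcg_poly[OF pcg_pderiv[OF pcg_poly1[OF n(1,2)]] \<open>X \<in> R\<close>] .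
  then have "cg 1 (s * poly (pderiv (poly1 r)) X) (s * (- ((- 1) ^ r * bernpoly n X)))"
    using assms by (intro cg_mult_left)
  then have "cg (1 + 1) (of_nat p ^ 1 * (s * poly (pderiv (poly1 r)) X)) (of_nat p ^ 1 * (s * (- ((- 1) ^ r * bernpoly n X))))"
    by (simp only: cg_p_power_mult_iff)
  then have 2: "cg 2 (of_nat p * (s * poly (pderiv (poly1 r)) X)) (of_nat p * (s * (- ((- 1) ^ r * bernpoly n X))))"
    by (simp add: numeral_2_eq_2)
  from cg_add[OF cg_sym[OF 1] 2] show ?thesis
    by (simp add: n_def algebra_simps)
qed

lemma cg_power_p_diff:
  assumes "m < p"
  shows "cg 1 ((- of_nat m) ^ p + of_nat m) 0"
proof (cases "m = 0")
  case False
  then have "cg 1 (of_nat m * of_nat m ^ (p - 1)) (of_nat m * 1)"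
    using assms by (intro cg_mult_left cg_fermat) auto
  then have "cg 1 (- (of_nat m * of_nat m ^ (p - 1)) + of_nat m) (- (of_nat m * 1) + of_nat m)"
    by (intro cg_add cg_uminus cg_refl)
  moreover have "(- of_nat m) ^ p = (- (of_nat m * of_nat m ^ (p - 1)) :: 'a)"
    using odd_p power_eq_if[of "of_nat m :: 'a" p] by (simp add: power_minus_odd)
  ultimately show ?thesis
    by simp
qed (simp add: power_0_left)

subsection \<open>Harmonic numbers modulo powers of p\<close>

text \<open>The binomial series of \<open>(1 - p / j) ^ (- t)\<close> to second order. For
  \<open>t = 1\<close> it is a geometric series with exact remainder \<open>p ^ 3 u ^ 3 v\<close>;
  each further factor updates the quadratic coefficient \<open>T t\<close>, a triangular
  number.\<close>

lemma cg_inverse_power_diff_p: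
  assumes "0 < j" "j < p"
  shows "cg 3 (1 / (of_nat j - of_nat p) ^ t)
           (1 / of_nat j ^ t + of_nat t * of_nat p * (1 / of_nat j ^ (t + 1))
            + of_nat t * (of_nat t + 1) / 2 * of_nat p ^ 2 * (1 / of_nat j ^ (t + 2)))"
proof -
  define u v :: 'a where "u = 1 / of_nat j" and "v = 1 / (of_nat j - of_nat p)"
  have uR: "u \<in> R"
    unfolding u_def using assms by (intro inverse_of_nat_closed)
  have "v = - (1 / of_nat (p - j))"
    using assms by (simp add: v_def of_nat_diff minus_divide_right)
  moreover have "- (1 / of_nat (p - j)) \<in> R"
    using assms by (intro uminus_closed inverse_of_nat_closed) auto
  ultimately have vR: "v \<in> R"
    by simp
  have nz: "of_nat j \<noteq> (0::'a)" "of_nat j - of_nat p \<noteq> (0::'a)"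
    using assms by auto
  have "v - (u + of_nat p * u ^ 2 + of_nat p ^ 2 * u ^ 3) = of_nat p ^ 3 * (u ^ 3 * v)"
    using nz unfolding u_def v_def by (simp add: field_simps power2_eq_square power3_eq_cube)
  moreover have "u ^ 3 * v \<in> R"
    using uR vR by (intro mult_closed power_closed)
  ultimately have v: "cg 3 v (u + of_nat p * u ^ 2 + of_nat p ^ 2 * u ^ 3)"
    by (simp add: cg_def)
  define T where "T t = of_nat t * (of_nat t + 1) / (2 :: 'a)" for t
  have TR: "T t \<in> R" for t
    unfolding T_def by (intro divide_2_closed mult_closed add_closed) auto
  have "cg 3 (v ^ t) (u ^ t * (1 + of_nat t * (of_nat p * u) + T t * (of_nat p * u) ^ 2))"
  proof (induction t)
    case 0
    show ?case
      by (simp add: T_def)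
  next
    case (Suc t)
    define y where "y = of_nat p * u"
    have yR: "y \<in> R"
      unfolding y_def using uR by (intro mult_closed of_nat_closed)
    have T_Suc: "T (Suc t) = T t + of_nat t + 1"
      by (simp add: T_def field_simps)
    have "cg 3 (v * v ^ t) ((u + of_nat p * u ^ 2 + of_nat p ^ 2 * u ^ 3) * (u ^ t * (1 + of_nat t * y + T t * y ^ 2)))"
      by (intro cg_mult v Suc.IH[folded y_def] vR mult_closed power_closed add_closed uR yR TR of_nat_closed one_closed)
    also have "(u + of_nat p * u ^ 2 + of_nat p ^ 2 * u ^ 3) * (u ^ t * (1 + of_nat t * y + T t * y ^ 2)) =
        u ^ Suc t * (1 + of_nat (Suc t) * y + T (Suc t) * y ^ 2) + of_nat p ^ 3 * (u ^ Suc t * u ^ 3 * (T t + of_nat t + T t * y))"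
      unfolding T_Suc y_def by (simp add: power2_eq_square power3_eq_cube algebra_simps)
    also have "cg 3 \<dots> (u ^ Suc t * (1 + of_nat (Suc t) * y + T (Suc t) * y ^ 2) + 0)"
      by (intro cg_add cg_refl cg_p_power_0 mult_closed power_closed add_closed uR yR TR of_nat_closed)
    finally show ?case
      by (simp add: y_def)
  qed
  also have "u ^ t * (1 + of_nat t * (of_nat p * u) + T t * (of_nat p * u) ^ 2) =
      1 / of_nat j ^ t + of_nat t * of_nat p * (1 / of_nat j ^ (t + 1))
            + of_nat t * (of_nat t + 1) / 2 * of_nat p ^ 2 * (1 / of_nat j ^ (t + 2))"
    using nz(1) by (simp add: u_def T_def field_simps power2_eq_square)
  finally show ?thesis
    by (simp add: v_def power_one_over)
qed

text \<open>The substitution \<open>j \<mapsto> p - j\<close> on the omitted tail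
  \<open>p - m, ..., p - 1\<close>, where oddness of \<open>t\<close> absorbs the minus
  sign.\<close>

lemma gharm_reflect:
  assumes "m < p" "odd t"
  shows "gharm t (p - 1 - m) = gharm t (p - 1) + (\<Sum>j=1..m. 1 / (of_nat j - of_nat p) ^ t :: 'a)"
  using assms(1)
proof (induction m)
  case (Suc m)
  define q where "q = p - 1 - Suc m"
  have q: "p - 1 - m = Suc q" "of_nat (Suc q) = (of_nat p - of_nat (Suc m) :: 'a)"
    using Suc.prems by (auto simp: q_def of_nat_diff)
  have "(of_nat (Suc m) - of_nat p :: 'a) ^ t = - ((of_nat p - of_nat (Suc m)) ^ t)"
    using \<open>odd t\<close> by (metis minus_diff_eq power_minus_odd)
  then have "1 / (of_nat (Suc m) - of_nat p :: 'a) ^ t = - (1 / (of_nat p - of_nat (Suc m)) ^ t)"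
    by simp
  moreover have "gharm t q = gharm t (p - 1 - m) - 1 / (of_nat p - of_nat (Suc m) :: 'a) ^ t"
    unfolding q(1) gharm_Suc q(2) by simp
  ultimately show ?case
    using Suc by (simp add: q_def del: of_nat_Suc)
qed auto

lemma cg_gharm_reflect:
  assumes "m < p" "odd t"
  shows "cg 3 (gharm t (p - 1 - m)) (gharm t (p - 1) + (gharm t m + of_nat t * of_nat p * gharm (t + 1) m
           + of_nat t * (of_nat t + 1) / 2 * of_nat p ^ 2 * gharm (t + 2) m))"
proof -
  have "cg 3 (\<Sum>j=1..m. 1 / (of_nat j - of_nat p) ^ t)
      (gharm t m + of_nat t * of_nat p * gharm (t + 1) m + of_nat t * (of_nat t + 1) / 2 * of_nat p ^ 2 * gharm (t + 2) m)"
    unfolding gharm_def sum_distrib_left sum.distrib[symmetric]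
    using assms by (intro cg_sum cg_inverse_power_diff_p) auto
  then show ?thesis
    unfolding gharm_reflect[OF assms] by (intro cg_add cg_refl)
qed

text \<open>The reflection at \<open>m = p - 1\<close> has an empty sum on the left and
  \<open>gharm t (p - 1)\<close> twice on the right; its quadratic term drops since
  \<open>gharm (t + 2) (p - 1)\<close> is divisible by \<open>p\<close>.\<close>

lemma cg_gharm_odd:
  assumes "odd t" "t + 4 \<le> p"
  shows "cg 3 (2 * gharm t (p - 1)) (- of_nat t * of_nat p * gharm (t + 1) (p - 1))"
proof -
  have "cg 1 (of_nat t * (of_nat t + 1) / 2 * gharm (t + 2) (p - 1)) (of_nat t * (of_nat t + 1) / 2 * 0)"
    using assms by (intro cg_mult_left gharm_p_minus_1_cg_0 divide_2_closed mult_closed add_closed) auto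
  then have "cg (2 + 1) (of_nat p ^ 2 * (of_nat t * (of_nat t + 1) / 2 * gharm (t + 2) (p - 1))) (of_nat p ^ 2 * 0)"
    unfolding cg_p_power_mult_iff by simp
  then have 0: "cg 3 (of_nat t * (of_nat t + 1) / 2 * of_nat p ^ 2 * gharm (t + 2) (p - 1)) 0"
    by (simp add: ac_simps numeral_3_eq_3)
  have "cg 3 0 (gharm t (p - 1) + (gharm t (p - 1) + of_nat t * of_nat p * gharm (t + 1) (p - 1)
           + of_nat t * (of_nat t + 1) / 2 * of_nat p ^ 2 * gharm (t + 2) (p - 1)))"
    using cg_gharm_reflect[of "p - 1" t] assms by simp
  also have "cg 3 \<dots> (gharm t (p - 1) + (gharm t (p - 1) + of_nat t * of_nat p * gharm (t + 1) (p - 1) + 0))"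
    by (intro cg_add cg_refl 0)
  finally have "cg 3 (- (of_nat t * of_nat p * gharm (t + 1) (p - 1)) + 0)
      (- (of_nat t * of_nat p * gharm (t + 1) (p - 1)) + (gharm t (p - 1) + (gharm t (p - 1) + of_nat t * of_nat p * gharm (t + 1) (p - 1) + 0)))"
    by (intro cg_add cg_refl)
  moreover have "- (of_nat t * of_nat p * gharm (t + 1) (p - 1)) + (gharm t (p - 1) + (gharm t (p - 1) + of_nat t * of_nat p * gharm (t + 1) (p - 1) + 0)) =
      2 * gharm t (p - 1)"
    by (simp add: algebra_simps)
  ultimately show ?thesis
    using cg_sym by fastforce
qed

lemma mhsum_p_minus_1_cg_0:
  assumes "r > 0" "r + 2 \<le> p"
  shows "cg 1 (mhsum (p - 1) (replicate r 1)) 0"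
proof -
  obtain q where r: "r = Suc q"
    using assms gr0_conv_Suc by blast
  have "cg 1 (mhsum (p - 1) (replicate (q - i) 1) * gharm (1 * Suc i) (p - 1)) (mhsum (p - 1) (replicate (q - i) 1) * 0)"
    if "i \<le> q" for i
    using that assms r by (intro cg_mult_left mhsum_closed gharm_p_minus_1_cg_0) simp_all
  then have "cg 1 (\<Sum>i\<le>q. gharm (1 * Suc i) (p - 1) * mhsum (p - 1) (replicate (q - i) 1)) (\<Sum>i\<le>q. 0)"
    by (intro cg_sum) (simp add: mult.commute)
  then have "cg 1 (of_nat (Suc q) * mhsum (p - 1) (replicate r 1)) 0"
    unfolding r mhsum_newton by simp
  from cg_mult_left[OF inverse_of_nat_closed this, of "Suc q"] show ?thesis
    using assms r by (simp del: of_nat_Suc replicate.simps)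
qed

text \<open>In Newton's identity every summand but the last is a product of two sums that are each
  divisible by \<open>p\<close>.\<close>

lemma cg_mhsum_gharm:
  assumes "r > 0" "r + 2 \<le> p"
  shows "cg 2 (of_nat r * mhsum (p - 1) (replicate r 1)) (gharm r (p - 1))"
proof -
  obtain q where r: "r = Suc q"
    using assms gr0_conv_Suc by blast
  have "cg 2 (gharm (1 * Suc i) (p - 1) * mhsum (p - 1) (replicate (q - i) 1)) 0" if "i < q" for i
  proof -
    have "gharm (1 * Suc i) (p - 1) / of_nat p ^ 1 * (mhsum (p - 1) (replicate (q - i) 1) / of_nat p ^ 1) \<in> R"
      using that assms r gharm_p_minus_1_cg_0[of "1 * Suc i"] mhsum_p_minus_1_cg_0[of "q - i"]
      unfolding cg_0_0 by (intro mult_closed) simp_all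
    then show ?thesis
      unfolding cg_0_0 by (simp add: power2_eq_square)
  qed
  then have "cg 2 (\<Sum>i<q. gharm (1 * Suc i) (p - 1) * mhsum (p - 1) (replicate (q - i) 1)) (\<Sum>i<q. 0)"
    by (intro cg_sum) auto
  then have "cg 2 ((\<Sum>i<q. gharm (1 * Suc i) (p - 1) * mhsum (p - 1) (replicate (q - i) 1)) + gharm r (p - 1)) (0 + gharm r (p - 1))"
    by (intro cg_add cg_refl) simp
  then show ?thesis
    unfolding r mhsum_newton lessThan_Suc_atMost[symmetric] sum.lessThan_Suc by (simp add: mhsum_0[simplified])
qed

text \<open>At \<open>X = 1\<close> the first congruence expresses \<open>mhsum (p - 1) (replicate e 1)\<close> by \<open>gharm e (p - 1)\<close>,
  and so do Newton's identities, with different coefficients.\<close>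

lemma cg_gharm_even:
  assumes "even e" "e > 0" "e + 2 < p"
  shows "cg 2 (of_nat (e + 1) * gharm e (p - 1)) (of_nat e * of_nat p * bernpoly (p - e - 1) 0)"
proof -
  obtain r where e: "e = Suc r"
    using assms gr0_conv_Suc by blast
  define E :: 'a where "E = gharm e (p - 1)"
  define b :: 'a where "b = bernpoly (p - e - 1) 0"
  obtain q where q: "p - e - 1 = Suc q" "q > 0"
    using assms by (intro that[of "p - e - 2"]) auto
  have b: "bernpoly (p - r - 2) 1 = b"
    using bernpoly_1[of q] q e by (simp add: b_def)
  \<comment> \<open>The point \<open>1 = - (p - 1) + p\<close> has \<open>m = p - 1\<close> and
    \<open>s = 1\<close>.\<close>
  have "cg 2 (poly (poly1 r) 1) (- gharm (r + 1) (p - 1) - (- 1) ^ r * 1 * of_nat p * bernpoly (p - r - 2) 1)"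
    using assms e by (intro cg_poly1) (auto simp: of_nat_diff Suc_le_eq)
  also have "poly (poly1 r) 1 = mhsum (p - 1) (replicate e 1)"
  proof -
    have "(\<Sum>k<n. mhsum (Suc k) (replicate r 1) / of_nat (Suc k)) = (mhsum n (replicate e 1) :: 'a)" for n
      by (induction n) (simp_all add: e mhsum_Suc del: of_nat_Suc replicate.simps)
    then show ?thesis
      unfolding poly_poly1 by (simp add: pochhammer_fact[symmetric] del: of_nat_Suc replicate.simps fact_Suc)
  qed
  also have "(- gharm (r + 1) (p - 1) - (- 1) ^ r * 1 * of_nat p * bernpoly (p - r - 2) 1) = - E + of_nat p * b"
    unfolding b using \<open>even e\<close> by (simp add: e E_def)
  finally have "cg 2 (of_nat e * mhsum (p - 1) (replicate e 1)) (of_nat e * (- E + of_nat p * b))"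
    by (rule cg_mult_left[OF of_nat_closed])
  moreover have "cg 2 (of_nat e * mhsum (p - 1) (replicate e 1)) E"
    unfolding E_def using assms by (intro cg_mhsum_gharm) auto
  ultimately have "cg 2 E (of_nat e * (- E + of_nat p * b))"
    using cg_sym cg_trans by blast
  \<comment> \<open>With the multiple harmonic sum eliminated, collecting \<open>E\<close> produces
    the coefficient \<open>e + 1\<close>.\<close>
  then have "cg 2 (of_nat e * E + E) (of_nat e * E + of_nat e * (- E + of_nat p * b))"
    by (intro cg_add cg_refl)
  then show ?thesis
    by (simp add: E_def b_def algebra_simps)
qed

lemma cg_gharm_odd_bernpoly:
  assumes "odd t" "t + 4 \<le> p"
  shows "cg 3 (2 * gharm t (p - 1)) (- (of_nat t * (of_nat t + 1) / (of_nat t + 2)) * of_nat p ^ 2 * bernpoly (p - t - 2) 0)"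
proof -
  have *: "cg 2 (of_nat (t + 1 + 1) * gharm (t + 1) (p - 1)) (of_nat (t + 1) * of_nat p * bernpoly (p - (t + 1) - 1) 0)"
    using assms by (intro cg_gharm_even) auto
  \<comment> \<open>The even case with \<open>e = t + 1\<close> carries the factor
    \<open>t + 2\<close>, which is below \<open>p\<close> and can be divided out.\<close>
  have "- (of_nat t / of_nat (t + 2)) \<in> R"
    using assms by (intro uminus_closed divide_of_nat_closed of_nat_closed) auto
  from cg_mult_left[OF this *]
  have "cg 2 (- (of_nat t / of_nat (t + 2)) * (of_nat (t + 1 + 1) * gharm (t + 1) (p - 1)))
      (- (of_nat t / of_nat (t + 2)) * (of_nat (t + 1) * of_nat p * bernpoly (p - (t + 1) - 1) 0))" .
  moreover have "of_nat (t + 2) \<noteq> (0 :: 'a)" "of_nat (t + 1 + 1) = (of_nat (t + 2) :: 'a)" "p - (t + 1) - 1 = p - t - 2"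
    by (simp_all del: of_nat_add of_nat_Suc)
  ultimately have "cg 2 (- of_nat t * gharm (t + 1) (p - 1))
      (- (of_nat t * of_nat (t + 1) / of_nat (t + 2)) * of_nat p * bernpoly (p - t - 2) 0)"
    by (simp add: mult.assoc del: of_nat_add of_nat_Suc)
  then have "cg 2 (- of_nat t * gharm (t + 1) (p - 1)) (- (of_nat t * (of_nat t + 1) / (of_nat t + 2)) * of_nat p * bernpoly (p - t - 2) 0)"
    by (simp add: add.commute)
  then have "cg (1 + 2) (of_nat p ^ 1 * (- of_nat t * gharm (t + 1) (p - 1)))
     (of_nat p ^ 1 * (- (of_nat t * (of_nat t + 1) / (of_nat t + 2)) * of_nat p * bernpoly (p - t - 2) 0))"
    unfolding cg_p_power_mult_iff .
  then have "cg 3 (- of_nat t * of_nat p * gharm (t + 1) (p - 1))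
     (- (of_nat t * (of_nat t + 1) / (of_nat t + 2)) * of_nat p ^ 2 * bernpoly (p - t - 2) 0)"
    by (simp add: power2_eq_square ac_simps numeral_3_eq_3)
  with cg_gharm_odd[OF assms] show ?thesis
    by (rule cg_trans)
qed

text \<open>For odd \<open>n = p - t - 3\<close>, \<open>B_(n+1)(- m)\<close> equals
  \<open>B_(n+1)(1 + m)\<close>, which differs from \<open>B_(n+1)(0)\<close> by
  \<open>n + 1\<close> times a power sum. Modulo \<open>p\<close>, \<open>n + 1\<close> is
  \<open>- (t + 2)\<close> and the exponent \<open>n\<close> stands for
  \<open>- (t + 2)\<close>.\<close>

lemma cg_bernpoly_neg_of_nat:
  assumes "odd t" "t + 4 \<le> p" "m < p"
  shows "cg 1 (bernpoly (p - t - 2) (- of_nat m)) (bernpoly (p - t - 2) 0 - (of_nat t + 2) * gharm (t + 2) m)"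
proof -
  define n where "n = p - t - 3"
  have n: "p - t - 2 = Suc n" "p = n + t + 3" "n > 0"
    using assms by (auto simp: n_def)
  then have "odd n"
    using assms(1) odd_p by simp
  have "bernpoly (Suc n) (- of_nat m) = (bernpoly (Suc n) (1 + of_nat m) :: 'a)"
    using bernpoly_reflect[of "Suc n" "1 + of_nat m :: 'a"] \<open>odd n\<close> by simp
  also have "\<dots> = bernpoly (Suc n) 0 + of_nat (Suc n) * (\<Sum>j=1..m. of_nat j ^ n)"
    using bernpoly_sum_powers[of n m, where 'a = 'a] n(3) by (simp add: bernpoly_1 algebra_simps)
  also have "cg 1 \<dots> (bernpoly (Suc n) 0 + - of_nat (t + 2) * gharm (t + 2) m)"
  proof (intro cg_add cg_refl cg_mult cg_sum_powers)
    show "cg 1 (of_nat (Suc n)) (- of_nat (t + 2))"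
    proof -
      have "of_nat (Suc n) - - of_nat (t + 2) = (of_nat p :: 'a)"
        unfolding n(2) by simp
      then show ?thesis
        by (simp only: cg_def) simp
    qed
  qed (use n assms in \<open>auto intro: gharm_closed\<close>)
  finally show ?thesis
    unfolding n(1) by (simp add: algebra_simps)
qed

subsection \<open>The second congruence\<close>

definition poly2 :: "nat \<Rightarrow> 'a poly" where
  "poly2 r = (\<Sum>k<p-1. smult (mhsum (Suc k) (replicate r 2) / of_nat (Suc k) / fact (Suc k) / fact (Suc k))
     (\<Prod>i\<le>k. [:of_nat i, 1:] * [:1 + of_nat i, - 1:]))"

lemma poly_poly2:
  "poly (poly2 r) x = (\<Sum>k<p-1. pochhammer x (Suc k) * pochhammer (1 - x) (Suc k) / fact (Suc k) ^ 2
     * (mhsum (Suc k) (replicate r 2) / of_nat (Suc k)))"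
proof -
  have "poly (\<Prod>i\<le>k. [:of_nat i, 1:] * [:1 + of_nat i, - 1:]) x = pochhammer x (Suc k) * pochhammer (1 - x) (Suc k)" for k
    by (simp add: poly_prod pochhammer_prod atLeast0LessThan lessThan_Suc_atMost algebra_simps flip: prod.distrib del: prod.atMost_Suc prod.lessThan_Suc)
  then show ?thesis
    unfolding poly2_def poly_sum poly_smult
    by (intro sum.cong) (simp_all add: power2_eq_square ac_simps del: fact_Suc of_nat_Suc replicate.simps)
qed

lemma Rpoly_poly2: "Rpoly (poly2 r)"
  unfolding poly2_def
  by (intro Rpoly_sum Rpoly_smult Rpoly_prod Rpoly_mult divide_fact_closed divide_of_nat_closed mhsum_closed)
    (auto intro: uminus_closed add_closed)

lemma degree_poly2: "degree (poly2 r) \<le> 2 * (p - 1)"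
proof -
  have "degree (\<Prod>i\<le>k. [:of_nat i, 1::'a:] * [:1 + of_nat i, - 1:]) \<le> 2 * Suc k" for k
  proof -
    have "degree ([:of_nat i, 1::'a:] * [:1 + of_nat i, - 1:]) = 2" for i
      by (subst degree_mult_eq) auto
    then show ?thesis
      using degree_prod_sum_le[of "{..k}" "\<lambda>i. [:of_nat i, 1::'a:] * [:1 + of_nat i, - 1:]"] by simp
  qed
  then show ?thesis
    unfolding poly2_def
    by (intro degree_sum_le order.trans[OF degree_smult_le] order.trans[OF \<open>\<And>k. degree _ \<le> 2 * Suc k\<close>]) auto
qed

lemma poly2_eval: "m < p \<Longrightarrow> poly (poly2 r) (- of_nat m) = - 2 * gharm (2 * r + 1) m"
  unfolding poly_poly2 using sum_pochhammer_pochhammer_mhsum_div[of m "p - 1" r, where 'a = 'a] by simp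

lemma poly2_reflect: "poly (poly2 r) (1 - x) = poly (poly2 r) x"
  by (simp add: poly_poly2 mult.commute[of "pochhammer (1 - x) _"])

text \<open>The symmetry \<open>x \<mapsto> 1 - x\<close> evaluates \<open>poly2 r\<close> exactly at \<open>p - m\<close> as well as at \<open>- m\<close>,
  and Taylor's formula compares the two values.\<close>

lemma cg_pderiv_poly2:
  assumes t: "t = 2 * r + 1" and "t + 4 \<le> p" "m < p"
  shows "cg 2 (poly (pderiv (poly2 r)) (- of_nat m) + of_nat p / 2 * poly (pderiv (pderiv (poly2 r))) (- of_nat m))
           (- 2 * of_nat t * gharm (t + 1) m
             + of_nat t * (of_nat t + 1) / (of_nat t + 2) * of_nat p * bernpoly (p - t - 2) (- of_nat m))"
proof -
  define D1 D2 where "D1 = poly (pderiv (poly2 r)) (- of_nat m)" and "D2 = poly (pderiv (pderiv (poly2 r))) (- of_nat m)"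
  define H H1 H2 Hp where "H = (gharm t m :: 'a)" and "H1 = (gharm (t + 1) m :: 'a)" and "H2 = (gharm (t + 2) m :: 'a)"
    and "Hp = (gharm t (p - 1) :: 'a)"
  define P T b0 bm c :: 'a where "P = of_nat p" and "T = of_nat t" and "b0 = bernpoly (p - t - 2) 0"
    and "bm = bernpoly (p - t - 2) (- of_nat m)" and "c = T * (T + 1) / (T + 2)"
  have "odd t"
    using t by simp
  have T2: "T + 2 = of_nat (t + 2)" "T + 2 \<noteq> 0"
  proof -
    show "T + 2 = of_nat (t + 2)"
      by (simp add: T_def)
    then show "T + 2 \<noteq> 0"
      by (metis of_nat_eq_0_iff add_is_0 zero_neq_numeral)
  qed
  have cR: "c \<in> R"
    unfolding c_def T2 using assms by (intro divide_of_nat_closed mult_closed add_closed) (auto simp: T_def)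
  \<comment> \<open>Reflection takes \<open>p - m\<close> to \<open>- (p - 1 - m)\<close>, which is
    again among the residues where the value is known exactly.\<close>
  have "- of_nat m + of_nat p * 1 = 1 - (- of_nat (p - 1 - m) :: 'a)"
    using assms by (simp add: of_nat_diff)
  then have "poly (poly2 r) (- of_nat m + of_nat p * 1) = poly (poly2 r) (- of_nat (p - 1 - m))"
    by (simp only: poly2_reflect)
  also have "\<dots> = - 2 * gharm t (p - 1 - m)"
    unfolding t by (rule poly2_eval) (use p_pos in linarith)
  finally have "poly (poly2 r) (- of_nat m + of_nat p * 1) = - 2 * gharm t (p - 1 - m)" .
  moreover have "poly (poly2 r) (- of_nat m) = - 2 * H"
    using assms by (simp add: poly2_eval H_def)
  moreover have "cg 3 (poly (poly2 r) (- of_nat m + of_nat p * 1)) (poly (poly2 r) (- of_nat m) + of_nat p * 1 * D1 + of_nat p ^ 2 * 1 ^ 2 / 2 * D2)"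
    unfolding D1_def D2_def by (intro cg_taylor3 Rpoly_poly2) auto
  ultimately have "cg 3 (- 2 * gharm t (p - 1 - m)) (- 2 * H + P * 1 * D1 + P ^ 2 * 1 ^ 2 / 2 * D2)"
    by (simp only: P_def)
  then have 1: "cg 3 (- 2 * H + P * 1 * D1 + P ^ 2 * 1 ^ 2 / 2 * D2) (- 2 * gharm t (p - 1 - m))"
    by (rule cg_sym)
  have 2: "cg 3 (- 2 * gharm t (p - 1 - m)) (- 2 * (Hp + (H + T * P * H1 + T * (T + 1) / 2 * P ^ 2 * H2)))"
    unfolding Hp_def H_def H1_def H2_def T_def P_def
    by (intro cg_mult_left cg_gharm_reflect \<open>odd t\<close> assms) (auto intro: uminus_closed)
  have 3: "cg 3 (- 2 * Hp) (c * P ^ 2 * b0)"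
    using cg_uminus[OF cg_gharm_odd_bernpoly[OF \<open>odd t\<close> \<open>t + 4 \<le> p\<close>]]
    by (simp add: Hp_def c_def T_def P_def b0_def)
  \<comment> \<open>The term \<open>- T (T + 1) H2\<close> of the reflection is
    \<open>- c (T + 2) H2\<close>. Joined with \<open>c b0\<close>, which comes from
    \<open>- 2 Hp\<close>, it becomes a single Bernoulli value at \<open>- m\<close>.\<close>
  have 4: "cg 3 (c * P ^ 2 * (b0 - (T + 2) * H2)) (c * P ^ 2 * bm)"
  proof -
    have "cg 1 (c * (b0 - (T + 2) * H2)) (c * bm)"
      using cg_sym[OF cg_bernpoly_neg_of_nat[OF \<open>odd t\<close> \<open>t + 4 \<le> p\<close> \<open>m < p\<close>]] cR
      unfolding b0_def T_def H2_def bm_def by (intro cg_mult_left)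
    then have "cg (2 + 1) (P ^ 2 * (c * (b0 - (T + 2) * H2))) (P ^ 2 * (c * bm))"
      unfolding P_def cg_p_power_mult_iff .
    then show ?thesis
      by (simp add: mult.left_commute mult.assoc)
  qed
  have "cg 3 (P * D1 + P ^ 2 / 2 * D2) (- 2 * T * P * H1 + c * P ^ 2 * bm)"
  proof -
    have "cg 3 ((- 2 * H + P * 1 * D1 + P ^ 2 * 1 ^ 2 / 2 * D2) + 2 * H)
        (- 2 * (Hp + (H + T * P * H1 + T * (T + 1) / 2 * P ^ 2 * H2)) + 2 * H)"
      by (intro cg_add cg_refl cg_trans[OF 1 2])
    also have "\<dots> = - 2 * Hp + (- 2 * T * P * H1 - T * (T + 1) * P ^ 2 * H2)"
      by (simp add: field_simps)
    also have "cg 3 \<dots> (c * P ^ 2 * b0 + (- 2 * T * P * H1 - T * (T + 1) * P ^ 2 * H2))"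
      by (intro cg_add cg_refl 3)
    also have "\<dots> = c * P ^ 2 * (b0 - (T + 2) * H2) + (- 2 * T * P * H1)"
      using T2(2) unfolding c_def by (simp add: field_simps)
    also have "cg 3 \<dots> (c * P ^ 2 * bm + (- 2 * T * P * H1))"
      by (intro cg_add cg_refl 4)
    finally show ?thesis
      by (simp add: add.commute)
  qed
  then have "cg (1 + 2) (P ^ 1 * (D1 + P / 2 * D2)) (P ^ 1 * (- 2 * T * H1 + c * P * bm))"
    by (simp add: power2_eq_square algebra_simps numeral_3_eq_3)
  then show ?thesis
    unfolding P_def cg_p_power_mult_iff D1_def D2_def T_def H1_def c_def bm_def .
qed

lemma cg_1_pderiv_poly2:
  assumes "t = 2 * r + 1" "t + 4 \<le> p" "m < p"
  shows "cg 1 (poly (pderiv (poly2 r)) (- of_nat m)) (- 2 * of_nat t * gharm (t + 1) m)"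
proof -
  define D1 D2 where "D1 = poly (pderiv (poly2 r)) (- of_nat m)" and "D2 = poly (pderiv (pderiv (poly2 r))) (- of_nat m)"
  define c where "c = of_nat t * (of_nat t + 1) / of_nat (t + 2) * bernpoly (p - t - 2) (- of_nat m :: 'a)"
  have cR: "c \<in> R"
    unfolding c_def poly_bern_poly[symmetric] using assms
    by (intro mult_closed divide_of_nat_closed poly_closed Rpoly_bern_poly) (auto intro: uminus_closed add_closed)
  have DR: "D2 / 2 \<in> R"
    unfolding D2_def by (intro divide_2_closed poly_closed Rpoly_pderiv Rpoly_poly2 uminus_closed) auto
  have "cg 1 (D1 + of_nat p / 2 * D2) (- 2 * of_nat t * gharm (t + 1) m + of_nat p ^ 1 * c)"
    using cg_le[OF cg_pderiv_poly2[OF assms], of 1] by (simp add: D1_def D2_def c_def ac_simps)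
  also have "cg 1 \<dots> (- 2 * of_nat t * gharm (t + 1) m + 0)"
    by (intro cg_add cg_refl cg_p_power_0 cR)
  finally have "cg 1 (D1 + of_nat p / 2 * D2 - of_nat p ^ 1 * (D2 / 2)) (- 2 * of_nat t * gharm (t + 1) m + 0 - 0)"
    by (intro cg_diff cg_p_power_0 DR)
  then show ?thesis
    by (simp add: D1_def)
qed

text \<open>\<open>2 A\<close> already has the values of \<open>poly2 r\<close> at the residues. As
  \<open>X ^ p - X\<close> has derivative \<open>- 1\<close> there, \<open>C\<close> must be the
  excess of \<open>2 A'\<close> over the prescribed derivative
  \<open>- 2 t * gharm (t + 1) m\<close>, which \<open>2 t B\<close> represents modulo
  \<open>p\<close>.\<close>

lemma pcg_poly2:
  assumes t: "t = 2 * r + 1" and "t + 4 \<le> p"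
  defines "A \<equiv> power_sum_poly (p - 1 - t)" and "B \<equiv> power_sum_poly (p - 2 - t)"
  defines "C \<equiv> smult 2 (pderiv A) - smult (2 * of_nat t) B"
  shows "pcg (poly2 r) (smult 2 A + (monom 1 p - [:0, 1:]) * C)"
  unfolding pcg_def
proof (rule Rpoly_divide_p_if_double_roots[where A = "(\<lambda>m. - of_nat m) ` {..<p}"])
  have AB: "Rpoly A" "Rpoly B"
    unfolding A_def B_def using assms by (auto intro!: Rpoly_power_sum_poly)
  then have C: "Rpoly C"
    unfolding C_def by (intro Rpoly_diff Rpoly_smult Rpoly_pderiv mult_closed) auto
  have Q: "Rpoly (monom 1 p - [:0, 1:])"
    by (rule Rpoly_diff) (auto simp: Rpoly_def[of "monom _ _"])
  show "Rpoly (poly2 r - (smult 2 A + (monom 1 p - [:0, 1:]) * C))"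
    using AB C by (intro Rpoly_diff[OF Rpoly_poly2] Rpoly_add Rpoly_smult Rpoly_mult Q) auto
  show "degree (poly2 r - (smult 2 A + (monom 1 p - [:0, 1:]) * C)) < 2 * card ((\<lambda>m. - of_nat m :: 'a) ` {..<p})"
  proof -
    have A: "degree A \<le> p - 1" and B: "degree B \<le> p - 2"
      unfolding A_def B_def using assms degree_power_sum_poly[of "p - 1 - t"] degree_power_sum_poly[of "p - 2 - t"] by auto
    have "degree C \<le> p - 2"
      unfolding C_def using A B
      by (intro degree_diff_le order.trans[OF degree_smult_le]) (auto simp: degree_pderiv)
    moreover have "degree (monom 1 p - [:0, 1:] :: 'a poly) \<le> p"
      using p_gt_3 by (intro degree_diff_le degree_monom_le) auto
    ultimately have "degree ((monom 1 p - [:0, 1:]) * C) \<le> p + (p - 2)"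
      by (intro order.trans[OF degree_mult_le] add_mono)
    then have "degree (poly2 r - (smult 2 A + (monom 1 p - [:0, 1:]) * C)) \<le> 2 * (p - 1)"
      using A p_gt_3 by (intro degree_diff_le degree_add_le degree_poly2 order.trans[OF degree_smult_le]) auto
    then show ?thesis
      unfolding card_residues using p_gt_3 by linarith
  qed
  fix a :: 'a
  assume "a \<in> (\<lambda>m. - of_nat m) ` {..<p}"
  then obtain m where m: "a = - of_nat m" "m < p"
    by auto
  have aR: "a \<in> R"
    using m by auto
  have A: "cg 1 (poly A a) (- gharm t m)" and B: "cg 1 (poly B a) (- gharm (t + 1) m)"
    unfolding A_def B_def m(1) using assms m by (auto intro!: cg_poly_power_sum_poly[unfolded One_nat_def])
  have Qa: "cg 1 (poly (monom 1 p - [:0, 1:]) a) 0"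
    using cg_power_p_diff[OF m(2)] by (simp add: m(1) poly_monom)
  show "cg 1 (poly (poly2 r - (smult 2 A + (monom 1 p - [:0, 1:]) * C)) a) 0"
  proof -
    have "cg 1 (- 2 * gharm t m - (2 * poly A a + poly C a * poly (monom 1 p - [:0, 1:]) a)) (- 2 * gharm t m - (2 * (- gharm t m) + poly C a * 0))"
      using A Qa C aR by (intro cg_diff cg_refl cg_add cg_mult_left poly_closed) auto
    then show ?thesis
      using m t by (simp add: poly2_eval mult.commute)
  qed
  have Q': "pderiv (monom 1 p - [:0, 1:] :: 'a poly) = smult (of_nat p) (monom 1 (p - 1)) - 1"
    by (simp add: pderiv_diff pderiv_monom pderiv_pCons smult_monom one_pCons)
  show "cg 1 (poly (pderiv (poly2 r - (smult 2 A + (monom 1 p - [:0, 1:]) * C))) a) 0"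
  proof -
    have eq: "poly (pderiv (poly2 r - (smult 2 A + (monom 1 p - [:0, 1:]) * C))) a =
        poly (pderiv (poly2 r)) a - (2 * poly (pderiv A) a + (poly (pderiv C) a * poly (monom 1 p - [:0, 1:]) a + (of_nat p ^ 1 * (a ^ (p - 1) * poly C a) - (2 * poly (pderiv A) a - 2 * of_nat t * poly B a))))"
      unfolding pderiv_diff[of "poly2 r"] pderiv_add pderiv_mult Q'
      by (simp add: pderiv_smult poly_monom C_def algebra_simps)
    have "cg 1 (poly (pderiv (poly2 r - (smult 2 A + (monom 1 p - [:0, 1:]) * C))) a)
       (- 2 * of_nat t * gharm (t + 1) m - (2 * poly (pderiv A) a + (poly (pderiv C) a * 0 + (0 - (2 * poly (pderiv A) a - 2 * of_nat t * (- gharm (t + 1) m))))))"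
      unfolding eq using Qa B C aR cg_1_pderiv_poly2[OF t \<open>t + 4 \<le> p\<close> m(2)]
      by (intro cg_diff cg_add cg_mult_left cg_refl cg_p_power_0 mult_closed power_closed poly_closed Rpoly_pderiv) (auto simp: m(1))
    then show ?thesis
      by (simp add: algebra_simps)
  qed
qed (auto intro: residues_diff)

text \<open>At a residue \<open>Q\<close> and \<open>Q''\<close> vanish modulo \<open>p\<close> and
  \<open>Q'\<close> is \<open>- 1\<close>, so the second derivative is
  \<open>2 A'' - 2 C' = - 2 A'' + 4 t B'\<close>. This is
  \<open>2 (n + 1) + 4 t = 2 (p + t - 1)\<close> times a Bernoulli value.\<close>

lemma cg_pderiv_pderiv_poly2:
  assumes t: "t = 2 * r + 1" and "t + 4 \<le> p" "m < p"
  shows "cg 1 (poly (pderiv (pderiv (poly2 r))) (- of_nat m)) (2 * (of_nat t - 1) * bernpoly (p - t - 2) (- of_nat m))"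
proof -
  define n where "n = p - t - 2"
  define a :: 'a where "a = - of_nat m"
  define A B :: "'a poly" where "A = power_sum_poly (p - 1 - t)" and "B = power_sum_poly (p - 2 - t)"
  define C where "C = smult 2 (pderiv A) - smult (2 * of_nat t) B"
  have n: "p - 1 - t = Suc n" "p - 2 - t = n" "n > 0" "n + 2 \<le> p" "p = n + t + 2"
    using assms by (auto simp: n_def)
  have "even n"
    using odd_p t n(5) by simp
  have aR: "a \<in> R"
    by (auto simp: a_def)
  have AB: "Rpoly A" "Rpoly B"
    unfolding A_def B_def using n t by (auto intro!: Rpoly_power_sum_poly)
  then have C: "Rpoly C"
    unfolding C_def by (intro Rpoly_diff Rpoly_smult Rpoly_pderiv mult_closed) auto
  have b: "bernpoly n (1 - a) = bernpoly n a"
    using \<open>even n\<close> by (simp add: bernpoly_reflect)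
  have B': "poly (pderiv B) a = bernpoly n a"
    by (simp add: B_def n pderiv_power_sum_poly poly_pcompose b)
  have A'': "poly (pderiv (pderiv A)) a = - (of_nat (Suc n) * bernpoly n a)"
    by (simp add: A_def n pderiv_power_sum_poly pderiv_pcompose pderiv_bern_poly pderiv_pCons poly_pcompose b del: of_nat_Suc)
  define Q :: "'a poly" where "Q = monom 1 p - [:0, 1:]"
  have Q: "cg 1 (poly Q a) 0"
    using cg_power_p_diff[OF \<open>m < p\<close>] by (simp add: Q_def a_def poly_monom)
  have Q': "pderiv Q = smult (of_nat p) (monom 1 (p - 1)) - 1"
    by (simp add: Q_def pderiv_diff pderiv_monom pderiv_pCons smult_monom one_pCons)
  have "cg 1 (poly (pderiv (pderiv (poly2 r))) a) (poly (pderiv (pderiv (smult 2 A + Q * C))) a)"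
    unfolding A_def B_def C_def Q_def using aR by (intro pcg_poly pcg_pderiv pcg_poly2 assms)
  also have "poly (pderiv (pderiv (smult 2 A + Q * C))) a =
      poly (pderiv (pderiv C)) a * poly Q a
      + of_nat p ^ 1 * (poly (pderiv (monom 1 (p - 1))) a * poly C a + 2 * a ^ (p - 1) * poly (pderiv C) a)
      + (2 * poly (pderiv (pderiv A)) a - 2 * poly (pderiv C) a)"
    by (simp add: pderiv_add pderiv_mult pderiv_smult pderiv_diff Q' poly_monom algebra_simps)
  also have "cg 1 \<dots> (poly (pderiv (pderiv C)) a * 0 + 0 + (2 * poly (pderiv (pderiv A)) a - 2 * poly (pderiv C) a))"
    using aR C by (intro cg_add cg_refl cg_mult_left Q cg_p_power_0 add_closed mult_closed poly_closed Rpoly_pderiv power_closed)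
      (auto simp: Rpoly_def)
  also have "\<dots> = 2 * of_nat (Suc n) * bernpoly n a + 4 * of_nat t * bernpoly n a"
    by (simp add: C_def pderiv_diff pderiv_smult A'' B' algebra_simps)
  also have "\<dots> = 2 * (of_nat t - 1) * bernpoly n a + of_nat p ^ 1 * (2 * bernpoly n a)"
    by (subst n(5)) (simp add: algebra_simps)
  also have "cg 1 \<dots> (2 * (of_nat t - 1) * bernpoly n a + 0)"
    unfolding poly_bern_poly[symmetric] using aR n(4)
    by (intro cg_add cg_refl cg_p_power_0 mult_closed poly_closed Rpoly_bern_poly) auto
  finally show ?thesis
    by (simp add: a_def n_def)
qed

lemma cg_poly2:
  assumes "2 * r + 3 < p" "m < p" "s \<in> R" "X \<in> R" "X = - of_nat m + of_nat p * s"
  shows "cg 3 (poly (poly2 r) X)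
      (- 2 * gharm (2 * r + 1) m
          - 2 * (2 * of_nat r + 1) * s * of_nat p * gharm (2 * r + 2) m
          + 2 * s * (1 + 3 * s * of_nat r + 2 * s * of_nat r ^ 2) / (2 * of_nat r + 3)
              * of_nat p ^ 2 * bernpoly (p - 2 * r - 3) X)"
proof -
  define t where "t = 2 * r + 1"
  have t: "t + 4 \<le> p"
  proof -
    \<comment> \<open>The hypothesis alone gives \<open>p \<ge> 2 r + 4\<close>; parity supplies the
      missing unit for \<open>t + 4 \<le> p\<close>.\<close>
    have "p \<noteq> 2 * r + 4"
      using odd_p by auto
    then show ?thesis
      using assms(1) by (simp add: t_def)
  qed
  define D1 D2 where "D1 = poly (pderiv (poly2 r)) (- of_nat m)" and "D2 = poly (pderiv (pderiv (poly2 r))) (- of_nat m)"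
  define H H1 P T bm c :: 'a where "H = gharm t m" and "H1 = gharm (t + 1) m"
    and "P = of_nat p" and "T = of_nat t" and "bm = bernpoly (p - t - 2) (- of_nat m)" and "c = T * (T + 1) / (T + 2)"
  have T2: "T + 2 = of_nat (t + 2)" "T + 2 \<noteq> 0"
  proof -
    show "T + 2 = of_nat (t + 2)"
      by (simp add: T_def)
    then show "T + 2 \<noteq> 0"
      by (metis of_nat_eq_0_iff add_is_0 zero_neq_numeral)
  qed
  define d where "d = s * c + (s ^ 2 - s) * (T - 1)"
  have dR: "d \<in> R"
    unfolding d_def c_def T2(1) using t assms(3)
    by (intro add_closed mult_closed divide_of_nat_closed diff_closed power_closed) (auto simp: T_def)
  have 1: "cg 3 (s * (P * (D1 + P / 2 * D2))) (s * (P * (- 2 * T * H1 + c * P * bm)))"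
  proof -
    have "cg (1 + 2) (P ^ 1 * (D1 + P / 2 * D2)) (P ^ 1 * (- 2 * T * H1 + c * P * bm))"
      unfolding P_def cg_p_power_mult_iff D1_def D2_def T_def H1_def c_def bm_def
      by (intro cg_pderiv_poly2 t_def t assms(2))
    then have "cg 3 (P * (D1 + P / 2 * D2)) (P * (- 2 * T * H1 + c * P * bm))"
      by (simp add: numeral_3_eq_3)
    then show ?thesis
      by (rule cg_mult_left[OF assms(3)])
  qed
  have 2: "cg 3 ((s ^ 2 - s) / 2 * (P ^ 2 * D2)) ((s ^ 2 - s) / 2 * (P ^ 2 * (2 * (T - 1) * bm)))"
  proof -
    have "cg (2 + 1) (P ^ 2 * D2) (P ^ 2 * (2 * (T - 1) * bm))"
      unfolding P_def cg_p_power_mult_iff D2_def T_def bm_def by (intro cg_pderiv_pderiv_poly2 t_def t assms(2))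
    then have "cg 3 (P ^ 2 * D2) (P ^ 2 * (2 * (T - 1) * bm))"
      by (simp add: numeral_3_eq_3)
    moreover have "(s ^ 2 - s) / 2 \<in> R"
      using assms(3) by (intro divide_2_closed diff_closed power_closed)
    ultimately show ?thesis
      by (rule cg_mult_left[rotated])
  qed
  \<comment> \<open>Under the factor \<open>p ^ 2\<close> the Bernoulli value matters only modulo
    \<open>p\<close>, so its argument may move from \<open>- m\<close> to \<open>X\<close>.\<close>
  have 3: "cg 3 (d * (P ^ 2 * bm)) (d * (P ^ 2 * bernpoly (p - t - 2) X))"
  proof -
    have "cg 1 (bernpoly (p - t - 2) X) bm"
      unfolding bm_def assms(5) poly_bern_poly[symmetric] using t assms(3)
      by (intro cg_poly_add_p_mult Rpoly_bern_poly) auto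
    then have "cg (2 + 1) (P ^ 2 * bm) (P ^ 2 * bernpoly (p - t - 2) X)"
      unfolding P_def cg_p_power_mult_iff by (rule cg_sym)
    then have "cg 3 (P ^ 2 * bm) (P ^ 2 * bernpoly (p - t - 2) X)"
      by (simp add: numeral_3_eq_3)
    then show ?thesis
      by (rule cg_mult_left[OF dR])
  qed
  have "cg 3 (poly (poly2 r) (- of_nat m + of_nat p * s)) (poly (poly2 r) (- of_nat m) + of_nat p * s * D1 + of_nat p ^ 2 * s ^ 2 / 2 * D2)"
    unfolding D1_def D2_def using assms(3) by (intro cg_taylor3 Rpoly_poly2) auto
  then have "cg 3 (poly (poly2 r) X) (- 2 * H + P * s * D1 + P ^ 2 * s ^ 2 / 2 * D2)"
    using assms(2,5) by (simp add: poly2_eval H_def t_def P_def)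
  also have "- 2 * H + P * s * D1 + P ^ 2 * s ^ 2 / 2 * D2 =
      - 2 * H + s * (P * (D1 + P / 2 * D2)) + (s ^ 2 - s) / 2 * (P ^ 2 * D2)"
    by (simp add: field_simps power2_eq_square)
  also have "cg 3 \<dots> (- 2 * H + s * (P * (- 2 * T * H1 + c * P * bm)) + (s ^ 2 - s) / 2 * (P ^ 2 * (2 * (T - 1) * bm)))"
    by (intro cg_add cg_refl 1 2)
  also have "\<dots> = - 2 * H - 2 * T * s * P * H1 + d * (P ^ 2 * bm)"
    unfolding d_def by (simp add: field_simps power2_eq_square)
  also have "cg 3 \<dots> (- 2 * H - 2 * T * s * P * H1 + d * (P ^ 2 * bernpoly (p - t - 2) X))"
    by (intro cg_add cg_refl 3)
  also have "d = 2 * s * (1 + 3 * s * of_nat r + 2 * s * of_nat r ^ 2) / (2 * of_nat r + 3)"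
  proof -
    have T: "T = 2 * of_nat r + 1" "2 * of_nat r + 3 \<noteq> (0 :: 'a)"
      using T2(2) by (simp_all add: T_def t_def algebra_simps)
    show ?thesis
      unfolding d_def c_def T(1) using T(2) by (simp add: divide_simps power2_eq_square) (simp add: algebra_simps)
  qed
  finally have "cg 3 (poly (poly2 r) X) (- 2 * H - 2 * T * s * P * H1
      + 2 * s * (1 + 3 * s * of_nat r + 2 * s * of_nat r ^ 2) / (2 * of_nat r + 3) * (P ^ 2 * bernpoly (p - t - 2) X))" .
  moreover have "T = 2 * of_nat r + 1" "t + 1 = 2 * r + 2" "p - t - 2 = p - 2 * r - 3"
    by (simp_all add: T_def t_def)
  ultimately show ?thesis
    by (simp only: H_def H1_def P_def mult.assoc) (simp only: t_def)
qed

end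

section \<open>The ring of p-adic integers\<close>

lemma of_padic_int_diff: "of_padic_int (a - b) = of_padic_int a - of_padic_int b"
  by (simp add: of_padic_int_def)

lemma of_padic_int_uminus: "of_padic_int (- a) = - of_padic_int a"
  by (simp add: of_padic_int_def)

lemma of_padic_int_mult: "of_padic_int (a * b) = of_padic_int a * of_padic_int b"
  by (simp add: of_padic_int_def)

lemma of_padic_int_1: "of_padic_int 1 = 1"
  by (simp add: of_padic_int_def One_fract_def)

lemma of_padic_int_of_nat: "of_padic_int (of_nat n) = of_nat n"
  by (simp add: of_padic_int_def Fract_of_nat_eq)

text \<open>The inverse is assembled level by level: \<open>j\<close> is invertible modulo every
  \<open>p ^ n\<close>, and uniqueness of inverses makes the residues compatible.\<close>

lemma of_nat_dvd_1_padic_int: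
  assumes "0 < j" "j < CARD('p::prime_card)"
  shows "(of_nat j :: 'p padic_int) dvd 1"
proof -
  let ?p = "int CARD('p)"
  have p: "prime ?p"
    using prime_card[where 'a = 'p] by simp
  have "\<not> ?p dvd int j"
    using assms zdvd_not_zless by force
  then have "coprime (int j) (?p ^ n)" for n
    using p by (metis coprime_commute coprime_power_right_iff prime_imp_coprime)
  then have "\<exists>y. [int j * y = 1] (mod ?p ^ n)" for n
    using cong_solve_coprime_int by blast
  then obtain y where y: "\<And>n. [int j * y n = 1] (mod ?p ^ n)"
    by metis
  define f where "f n = y n mod ?p ^ n" for n
  have "f (Suc n) mod ?p ^ n = f n" for n
  proof -
    have "[int j * y (Suc n) = 1] (mod ?p ^ n)"
      by (rule cong_dvd_modulus[OF y[of "Suc n"]]) simp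
    then have "[int j * y (Suc n) = int j * y n] (mod ?p ^ n)"
      using y[of n] cong_sym cong_trans by blast
    then have "[y (Suc n) = y n] (mod ?p ^ n)"
      using \<open>coprime (int j) (?p ^ n)\<close> cong_mult_lcancel by blast
    then show ?thesis
      unfolding f_def mod_power_Suc_mod by (simp add: cong_def)
  qed
  then have res: "padic_residue (Abs_padic_int f :: 'p padic_int) = f"
    by (intro Abs_padic_int_inverse) simp
  have "padic_residue (of_nat j * Abs_padic_int f :: 'p padic_int) n = padic_residue (1 :: 'p padic_int) n" for n
    using y[of n] unfolding times_padic_int.rep_eq res padic_residue_of_nat one_padic_int.rep_eq f_def
    by (simp add: cong_def mod_simps)
  then have "of_nat j * Abs_padic_int f = (1 :: 'p padic_int)"
    by (simp add: padic_residue_inject[symmetric] fun_eq_iff)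
  then show ?thesis
    by (metis dvd_triv_left)
qed

lemma p_integral_padic_int:
  assumes "CARD('p::prime_card) > 3"
  shows "p_integral (range of_padic_int :: 'p padic set) CARD('p)"
proof
  show "prime CARD('p)" "CARD('p) > 3"
    using prime_card assms by auto
  show "(1 :: 'p padic) \<in> range of_padic_int"
    using of_padic_int_1 by (metis rangeI)
  show "a - b \<in> range of_padic_int" "a * b \<in> range of_padic_int"
    if "a \<in> range of_padic_int" "b \<in> range of_padic_int" for a b :: "'p padic"
    using that by (auto simp flip: of_padic_int_diff of_padic_int_mult)
  show "1 / of_nat j \<in> (range of_padic_int :: 'p padic set)" if j: "0 < j" "j < CARD('p)" for j
  proof -
    obtain y :: "'p padic_int" where "1 = of_nat j * y"
      using of_nat_dvd_1_padic_int[OF j] by (auto elim: dvdE)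
    then have "1 = of_nat j * of_padic_int y"
      by (metis of_padic_int_1 of_padic_int_mult of_padic_int_of_nat)
    then have "1 / of_nat j = of_padic_int y"
      using \<open>0 < j\<close> by (simp add: field_simps)
    then show ?thesis
      by simp
  qed
qed

text \<open>\<open>padic_cong\<close> demands that both sides be integral, which \<open>cg\<close>
  does not imply; integrality of \<open>a\<close> suffices, since the congruence transfers it to
  \<open>b\<close>.\<close>

lemma padic_cong_if_cg:
  fixes a b :: "'p::prime_card padic"
  assumes p: "CARD('p) > 3" and cg: "p_integral.cg (range of_padic_int) CARD('p) k a b"
    and a: "a \<in> range of_padic_int"
  shows "padic_cong a b (of_nat CARD('p) ^ k)"
proof -
  interpret p_integral "range of_padic_int :: 'p padic set" "CARD('p)"
    by (rule p_integral_padic_int[OF p])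
  obtain u v w where u: "a = of_padic_int u" and v: "b = of_padic_int v"
    and w: "(a - b) / of_nat CARD('p) ^ k = of_padic_int w"
    using a cg_closed[OF cg] cg unfolding cg_def by auto
  have "of_padic_int (u - v) = of_padic_int (of_nat (CARD('p) ^ k) * w)"
    unfolding of_padic_int_diff of_padic_int_mult of_padic_int_of_nat u[symmetric] v[symmetric] w[symmetric]
    by simp
  then have "u - v = of_nat CARD('p) ^ k * w"
    by (simp add: of_padic_int_def eq_fract)
  then show ?thesis
    unfolding padic_cong_def using u v by (intro exI[of _ u] exI[of _ v]) simp
qed

theorem theorem1:
  fixes x :: "'p :: prime_card padic_int" and X s :: "'p padic" and p m r :: nat
  assumes p: "p = CARD('p)"
    and X: "X = of_padic_int x"
    and m: "m = least_residue (- x)"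
    and s: "s = (X + of_nat m) / of_nat p"
  shows
    "(p > r + 3 \<longrightarrow>
       padic_cong
         (\<Sum>k=1..p-1. pochhammer X k / pochhammer 1 k * (mhsum k (replicate r 1) / of_nat k))
         (- gharm (r + 1) m - (- 1) ^ r * s * of_nat p * bernpoly (p - r - 2) X)
         (of_nat p ^ 2)) \<and>
     (p > 2 * r + 3 \<longrightarrow>
       padic_cong
         (\<Sum>k=1..p-1. pochhammer X k * pochhammer (1 - X) k / pochhammer 1 k ^ 2
                        * (mhsum k (replicate r 2) / of_nat k))
         (- 2 * gharm (2 * r + 1) m
          - 2 * (2 * of_nat r + 1) * s * of_nat p * gharm (2 * r + 2) m
          + 2 * s * (1 + 3 * s * of_nat r + 2 * s * of_nat r ^ 2) / (2 * of_nat r + 3)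
              * of_nat p ^ 2 * bernpoly (p - 2 * r - 3) X)
         (of_nat p ^ 3))"
proof -
  let ?R = "range of_padic_int :: 'p padic set"
  \<comment> \<open>As \<open>m\<close> is the residue of \<open>- x\<close>, this quotient shows
    that \<open>s = - y\<close> is a p-adic integer.\<close>
  obtain y where y: "- x - of_nat m = of_nat p * y"
    using least_residue(2)[of "- x"] p m by (auto elim: dvdE)
  have "m < p"
    using least_residue(1)[of "- x"] p m by simp
  have "x = - (of_nat p * y) - of_nat m"
    unfolding y[symmetric] by simp
  then have X_eq: "X = - (of_nat p * of_padic_int y) - of_nat m"
    by (simp add: X of_padic_int_diff of_padic_int_uminus of_padic_int_mult of_padic_int_of_nat)
  then have s_eq: "s = - of_padic_int y"
    using p by (simp add: s)
  have X_s: "X = - of_nat m + of_nat p * s"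
    unfolding X_eq s_eq by simp
  have sR: "s \<in> ?R"
    unfolding s_eq of_padic_int_uminus[symmetric] by simp
  have XR: "X \<in> ?R"
    by (simp add: X)
  have sums: "(\<Sum>k=1..p-1. f k) = (\<Sum>k<p-1. f (Suc k))" for f :: "nat \<Rightarrow> 'p padic"
    by (simp add: sum.atLeast1_atMost_eq)
  show ?thesis
  proof (intro conjI impI)
    assume r: "p > r + 3"
    then have p3: "CARD('p) > 3"
      using p by simp
    interpret p_integral ?R "CARD('p)"
      by (rule p_integral_padic_int[OF p3])
    show "padic_cong
         (\<Sum>k=1..p-1. pochhammer X k / pochhammer 1 k * (mhsum k (replicate r 1) / of_nat k))
         (- gharm (r + 1) m - (- 1) ^ r * s * of_nat p * bernpoly (p - r - 2) X) (of_nat p ^ 2)"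
      unfolding sums pochhammer_fact[symmetric]
      unfolding p poly_poly1[symmetric]
      using r \<open>m < p\<close> sR XR X_s unfolding p
      by (intro padic_cong_if_cg[OF p3] cg_poly1 poly_closed Rpoly_poly1)
  next
    assume r: "p > 2 * r + 3"
    then have p3: "CARD('p) > 3"
      using p by simp
    interpret p_integral ?R "CARD('p)"
      by (rule p_integral_padic_int[OF p3])
    show "padic_cong
         (\<Sum>k=1..p-1. pochhammer X k * pochhammer (1 - X) k / pochhammer 1 k ^ 2
                        * (mhsum k (replicate r 2) / of_nat k))
         (- 2 * gharm (2 * r + 1) m
          - 2 * (2 * of_nat r + 1) * s * of_nat p * gharm (2 * r + 2) m
          + 2 * s * (1 + 3 * s * of_nat r + 2 * s * of_nat r ^ 2) / (2 * of_nat r + 3)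
              * of_nat p ^ 2 * bernpoly (p - 2 * r - 3) X)
         (of_nat p ^ 3)"
      unfolding sums pochhammer_fact[symmetric]
      unfolding p poly_poly2[symmetric]
      using r \<open>m < p\<close> sR XR X_s unfolding p
      by (intro padic_cong_if_cg[OF p3] cg_poly2 poly_closed Rpoly_poly2)
  qed
qed

end
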